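(* Let $\acute N$ be a radical screen transversal lightlike submanifold of a locally metallic semi-Riemannian manifold $(\breve N,\breve g,\breve J)$. Then the radical distribution $Rad(T\acute N)$ is integrable if and only if one of the following holds: (a) $A_{\breve JW}U-A_{\breve JU}W=p\,(A^{*}_WU-A^{*}_UW)$ for all $W,U\in\Gamma(Rad(T\acute N))$; or (b) $A^{*}_WU=A^{*}_UW$ and $A_{\breve JW}U-A_{\breve JU}W\in\Gamma(Rad(T\acute N))$ for all $W,U\in\Gamma(Rad(T\acute N))$.
   Context: Fix positive integers $p,q$. A metallic semi-Riemannian manifold $(\breve N,\breve g,\breve J)$ is a semi-Riemannian manifold $(\breve N,\breve g)$ with a $(1,1)$-tensor field $\breve J$ such that $\breve J^2=p\breve J+qI$ and $\breve g(\breve JW,U)=\breve g(W,\breve JU)$ for all vector fields $W,U$ on $\breve N$. It is locally metallic if $\breve\nabla\breve J=0$, where $\breve\nabla$ is the Levi-Civita connection of $\breve g$. A submanifold $\acute N$ of dimension $m$ in $\breve N$ is lightlike if the metric $g$ induced from $\breve g$ is degenerate and $Rad(T\acute N)=T\acute N\cap T\acute N^{\perp}$ is a distribution of constant rank $r$, $1\le r\le m$. Fix a screen distribution $S(T\acute N)$ (non-degenerate complement of $Rad(T\acute N)$ in $T\acute N$), a screen transversal bundle $S(T\acute N^{\perp})$ (non-degenerate complement of $Rad(T\acute N)$ in $T\acute N^{\perp}$), and the associated lightlike transversal bundle $ltr(T\acute N)$: it is orthogonal to $S(T\acute N)$ and $S(T\acute N^\perp)$, and for any local basis $\{\xi_i\}$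 of $Rad(T\acute N)$ it is locally spanned by $\{N_i\}$ with $\breve g(\xi_i,N_j)=\delta_{ij}$, $\breve g(N_i,N_j)=0$. With $\oplus_{ort}$ denoting orthogonal direct sum, $T\breve N|_{\acute N}=S(T\acute N)\oplus_{ort}[Rad(T\acute N)\oplus ltr(T\acute N)]\oplus_{ort}S(T\acute N^{\perp})$. For $W,U\in\Gamma(T\acute N)$ and $Z\in\Gamma(S(T\acute N^\perp))$ write $\breve\nabla_WU=\nabla_WU+h^{\ell}(W,U)+h^s(W,U)$ and $\breve\nabla_WZ=-A_ZW+\nabla^s_WZ+D^{\ell}(W,Z)$, where $\nabla_WU,A_ZW\in\Gamma(T\acute N)$, $h^\ell(W,U),D^\ell(W,Z)\in\Gamma(ltr(T\acute N))$ and $h^s(W,U),\nabla^s_WZ\in\Gamma(S(T\acute N^\perp))$. For $W\in\Gamma(T\acute N)$ and $\xi\in\Gamma(Rad(T\acute N))$ write $\nabla_W\xi=-A^{*}_{\xi}W+\nabla^{*t}_W\xi$ with $A^{*}_\xi W\in\Gamma(S(T\acute N))$ and $\nabla^{*t}_W\xi\in\Gamma(Rad(T\acute N))$. $\acute N$ is radical screen transversal if $\breve J\,Rad(T\acute N)\subset S(T\acute N^{\perp})$ and $\breve J\,S(T\acute N)=S(T\acute N)$. *)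

theory Defs
  imports "HOL-Analysis.Analysis"
begin

section \<open>Smooth maps between Euclidean spaces\<close>

text \<open>Both notions are only used for open sets \<open>S\<close>.\<close>

primrec Ck_on :: "nat \<Rightarrow> 'e::euclidean_space set \<Rightarrow> ('e \<Rightarrow> 'b::real_normed_vector) \<Rightarrow> bool" where
  "Ck_on 0 S f \<longleftrightarrow> continuous_on S f"
| "Ck_on (Suc k) S f \<longleftrightarrow>
     (\<forall>x\<in>S. f differentiable (at x)) \<and> (\<forall>v. Ck_on k S (\<lambda>x. frechet_derivative f (at x) v))"

definition smooth_on :: "'e::euclidean_space set \<Rightarrow> ('e \<Rightarrow> 'b::real_normed_vector) \<Rightarrow> bool" where
  "smooth_on S f \<longleftrightarrow> (\<forall>k. Ck_on k S f)"


section \<open>Smooth manifolds\<close>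

text \<open>A manifold is given by an atlas. A chart is a pair of its domain and its coordinate map;
  coordinate maps are total functions whose values outside the domain are irrelevant.
  The dimension of the manifold is \<open>DIM('e)\<close>. The atlas determines the carrier set and the
  topology, so that two manifolds with points in the same type may have unrelated topologies.\<close>

type_synonym ('a, 'e) chart = "'a set \<times> ('a \<Rightarrow> 'e)"

abbreviation cdom :: "('a, 'e) chart \<Rightarrow> 'a set" where "cdom c \<equiv> fst c"
abbreviation cmap :: "('a, 'e) chart \<Rightarrow> 'a \<Rightarrow> 'e" where "cmap c \<equiv> snd c"
abbreviation cinv :: "('a, 'e) chart \<Rightarrow> 'e \<Rightarrow> 'a" where "cinv c \<equiv> inv_into (fst c) (snd c)"

definition carrier_of :: "('a, 'e) chart set \<Rightarrow> 'a set" where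
  "carrier_of A = (\<Union>c\<in>A. cdom c)"

definition mtop :: "('a, 'e::euclidean_space) chart set \<Rightarrow> 'a topology" where
  "mtop A = topology_generated_by {cdom c \<inter> cmap c -` G | c G. c \<in> A \<and> open G}"

definition smooth_manifold :: "('a, 'e::euclidean_space) chart set \<Rightarrow> bool" where
  "smooth_manifold A \<longleftrightarrow>
     (\<forall>c\<in>A. inj_on (cmap c) (cdom c) \<and> open (cmap c ` cdom c)) \<and>
     (\<forall>c\<in>A. \<forall>d\<in>A. open (cmap c ` (cdom c \<inter> cdom d)) \<and>
        smooth_on (cmap c ` (cdom c \<inter> cdom d)) (\<lambda>y. cmap d (cinv c y))) \<and>
     Hausdorff_space (mtop A) \<and> second_countable (mtop A)"

text \<open>The tangent space at \<open>x\<close> is the model space \<open>'e\<close>, a vector being identified with its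
  components in a preferred chart around \<open>x\<close>. \<open>vec_to A c x v\<close> are the components of
  \<open>v \<in> T\<^sub>xM\<close> in the chart \<open>c\<close>, and \<open>vec_from A c x e\<close> is the tangent vector at \<open>x\<close>
  with components \<open>e\<close> in the chart \<open>c\<close>.\<close>

definition chart_at :: "('a, 'e) chart set \<Rightarrow> 'a \<Rightarrow> ('a, 'e) chart" where
  "chart_at A x = (SOME c. c \<in> A \<and> x \<in> cdom c)"

definition vec_to ::
    "('a, 'e::euclidean_space) chart set \<Rightarrow> ('a, 'e) chart \<Rightarrow> 'a \<Rightarrow> 'e \<Rightarrow> 'e" where
  "vec_to A c x = frechet_derivative (\<lambda>y. cmap c (cinv (chart_at A x) y)) (at (cmap (chart_at A x) x))"

definition vec_from ::
    "('a, 'e::euclidean_space) chart set \<Rightarrow> ('a, 'e) chart \<Rightarrow> 'a \<Rightarrow> 'e \<Rightarrow> 'e" where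
  "vec_from A c x = frechet_derivative (\<lambda>y. cmap (chart_at A x) (cinv c y)) (at (cmap c x))"

definition smooth_fun_on ::
    "('a, 'e::euclidean_space) chart set \<Rightarrow> 'a set \<Rightarrow> ('a \<Rightarrow> real) \<Rightarrow> bool" where
  "smooth_fun_on A G f \<longleftrightarrow> (\<forall>c\<in>A. smooth_on (cmap c ` (cdom c \<inter> G)) (\<lambda>y. f (cinv c y)))"

definition smooth_vf_on ::
    "('a, 'e::euclidean_space) chart set \<Rightarrow> 'a set \<Rightarrow> ('a \<Rightarrow> 'e) \<Rightarrow> bool" where
  "smooth_vf_on A G X \<longleftrightarrow>
     (\<forall>c\<in>A. smooth_on (cmap c ` (cdom c \<inter> G)) (\<lambda>y. vec_to A c (cinv c y) (X (cinv c y))))"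

definition dir_deriv ::
    "('a, 'e::euclidean_space) chart set \<Rightarrow> ('a \<Rightarrow> real) \<Rightarrow> 'a \<Rightarrow> 'e \<Rightarrow> real" where
  "dir_deriv A f x v =
     frechet_derivative (\<lambda>y. f (cinv (chart_at A x) y)) (at (cmap (chart_at A x) x)) v"

definition lie_bracket ::
    "('a, 'e::euclidean_space) chart set \<Rightarrow> ('a \<Rightarrow> 'e) \<Rightarrow> ('a \<Rightarrow> 'e) \<Rightarrow> 'a \<Rightarrow> 'e" where
  "lie_bracket A X Y x =
     (let c = chart_at A x;
          loc = (\<lambda>Z y. vec_to A c (cinv c y) (Z (cinv c y)))
      in frechet_derivative (loc Y) (at (cmap c x)) (X x)
           - frechet_derivative (loc X) (at (cmap c x)) (Y x))"


section \<open>Semi-Riemannian metrics, Levi-Civita connection, metallic structures\<close>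

definition nondegenerate_on :: "'v set \<Rightarrow> ('v::real_vector \<Rightarrow> 'v \<Rightarrow> real) \<Rightarrow> bool" where
  "nondegenerate_on V b \<longleftrightarrow> (\<forall>v\<in>V. (\<forall>w\<in>V. b v w = 0) \<longrightarrow> v = 0)"

definition form_index :: "('e::euclidean_space \<Rightarrow> 'e \<Rightarrow> real) \<Rightarrow> nat" where
  "form_index b = Max {dim S | S. subspace S \<and> (\<forall>v\<in>S. v \<noteq> 0 \<longrightarrow> b v v < 0)}"

definition semi_riemannian ::
    "('a, 'e::euclidean_space) chart set \<Rightarrow> ('a \<Rightarrow> 'e \<Rightarrow> 'e \<Rightarrow> real) \<Rightarrow> bool" where
  "semi_riemannian A g \<longleftrightarrow>
     smooth_manifold A \<and>
     (\<forall>x\<in>carrier_of A. bilinear (g x) \<and> (\<forall>v w. g x v w = g x w v) \<and> nondegenerate_on UNIV (g x)) \<and>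
     (\<exists>k. \<forall>x\<in>carrier_of A. form_index (g x) = k) \<and>
     (\<forall>c\<in>A. \<forall>e e'. smooth_on (cmap c ` cdom c)
        (\<lambda>y. g (cinv c y) (vec_from A c (cinv c y) e) (vec_from A c (cinv c y) e')))"

text \<open>\<open>nab Y x v\<close> is \<open>(\<nabla>\<^sub>v Y)(x)\<close> for \<open>v \<in> T\<^sub>xM\<close>. Connections being local operators, \<open>Y\<close>
  only has to be smooth on an open neighbourhood of \<open>x\<close>, and nothing is demanded of \<open>nab\<close> on
  other fields.\<close>

definition affine_connection ::
    "('a, 'e::euclidean_space) chart set \<Rightarrow> (('a \<Rightarrow> 'e) \<Rightarrow> 'a \<Rightarrow> 'e \<Rightarrow> 'e) \<Rightarrow> bool" where
  "affine_connection A nab \<longleftrightarrow>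
     (\<forall>G Y. openin (mtop A) G \<and> smooth_vf_on A G Y \<longrightarrow>
        (\<forall>x\<in>G. linear (nab Y x)) \<and>
        (\<forall>X. smooth_vf_on A G X \<longrightarrow> smooth_vf_on A G (\<lambda>x. nab Y x (X x))) \<and>
        (\<forall>Z. (\<forall>y\<in>G. Z y = Y y) \<longrightarrow> (\<forall>x\<in>G. \<forall>v. nab Z x v = nab Y x v)) \<and>
        (\<forall>Z. smooth_vf_on A G Z \<longrightarrow>
           (\<forall>x\<in>G. \<forall>v. nab (\<lambda>y. Y y + Z y) x v = nab Y x v + nab Z x v)) \<and>
        (\<forall>f. smooth_fun_on A G f \<longrightarrow>
           (\<forall>x\<in>G. \<forall>v. nab (\<lambda>y. f y *\<^sub>R Y y) x v =
              dir_deriv A f x v *\<^sub>R Y x + f x *\<^sub>R nab Y x v)))"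

definition levi_civita ::
    "('a, 'e::euclidean_space) chart set \<Rightarrow> ('a \<Rightarrow> 'e \<Rightarrow> 'e \<Rightarrow> real) \<Rightarrow>
     (('a \<Rightarrow> 'e) \<Rightarrow> 'a \<Rightarrow> 'e \<Rightarrow> 'e) \<Rightarrow> bool" where
  "levi_civita A g nab \<longleftrightarrow>
     affine_connection A nab \<and>
     (\<forall>G X Y. openin (mtop A) G \<and> smooth_vf_on A G X \<and> smooth_vf_on A G Y \<longrightarrow>
        (\<forall>x\<in>G. nab Y x (X x) - nab X x (Y x) = lie_bracket A X Y x) \<and>
        (\<forall>x\<in>G. \<forall>v. dir_deriv A (\<lambda>y. g y (X y) (Y y)) x v =
           g x (nab X x v) (Y x) + g x (X x) (nab Y x v)))"

definition metallic_semi_riemannian ::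
    "nat \<Rightarrow> nat \<Rightarrow> ('a, 'e::euclidean_space) chart set \<Rightarrow> ('a \<Rightarrow> 'e \<Rightarrow> 'e \<Rightarrow> real) \<Rightarrow>
     ('a \<Rightarrow> 'e \<Rightarrow> 'e) \<Rightarrow> bool" where
  "metallic_semi_riemannian p q A g J \<longleftrightarrow>
     semi_riemannian A g \<and>
     (\<forall>x\<in>carrier_of A. linear (J x)) \<and>
     (\<forall>c\<in>A. \<forall>e. smooth_on (cmap c ` cdom c)
        (\<lambda>y. vec_to A c (cinv c y) (J (cinv c y) (vec_from A c (cinv c y) e)))) \<and>
     (\<forall>x\<in>carrier_of A. \<forall>v. J x (J x v) = real p *\<^sub>R J x v + real q *\<^sub>R v) \<and>
     (\<forall>x\<in>carrier_of A. \<forall>v w. g x (J x v) w = g x v (J x w))"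

definition locally_metallic ::
    "nat \<Rightarrow> nat \<Rightarrow> ('a, 'e::euclidean_space) chart set \<Rightarrow> ('a \<Rightarrow> 'e \<Rightarrow> 'e \<Rightarrow> real) \<Rightarrow>
     (('a \<Rightarrow> 'e) \<Rightarrow> 'a \<Rightarrow> 'e \<Rightarrow> 'e) \<Rightarrow> ('a \<Rightarrow> 'e \<Rightarrow> 'e) \<Rightarrow> bool" where
  "locally_metallic p q A g nab J \<longleftrightarrow>
     metallic_semi_riemannian p q A g J \<and> levi_civita A g nab \<and>
     (\<forall>G Y. openin (mtop A) G \<and> smooth_vf_on A G Y \<longrightarrow>
        (\<forall>x\<in>G. \<forall>v. nab (\<lambda>y. J y (Y y)) x v - J x (nab Y x v) = 0))"


section \<open>Submanifolds\<close>

text \<open>\<open>A\<close> is the atlas of the ambient manifold, \<open>B\<close> that of the submanifold, whose tangent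
  spaces are copies of \<open>'f\<close> embedded by the differential \<open>dincl A B x\<close> of the inclusion.
  Submanifolds are immersed: their own topology may be finer than the subspace topology.\<close>

definition dincl ::
    "('a, 'e::euclidean_space) chart set \<Rightarrow> ('a, 'f::euclidean_space) chart set \<Rightarrow> 'a \<Rightarrow> 'f \<Rightarrow> 'e" where
  "dincl A B x =
     frechet_derivative (\<lambda>y. cmap (chart_at A x) (cinv (chart_at B x) y)) (at (cmap (chart_at B x) x))"

definition submanifold ::
    "('a, 'e::euclidean_space) chart set \<Rightarrow> ('a, 'f::euclidean_space) chart set \<Rightarrow> bool" where
  "submanifold A B \<longleftrightarrow>
     smooth_manifold A \<and> smooth_manifold B \<and> carrier_of B \<subseteq> carrier_of A \<and>
     (\<forall>c\<in>A. \<forall>d\<in>B. open (cmap d ` (cdom d \<inter> cdom c)) \<and>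
        smooth_on (cmap d ` (cdom d \<inter> cdom c)) (\<lambda>y. cmap c (cinv d y))) \<and>
     (\<forall>x\<in>carrier_of B. inj (dincl A B x))"

text \<open>Smooth sections over \<open>G\<close> of the restriction to the submanifold of the ambient tangent
  bundle.\<close>

definition smooth_along_on ::
    "('a, 'e::euclidean_space) chart set \<Rightarrow> ('a, 'f::euclidean_space) chart set \<Rightarrow> 'a set \<Rightarrow>
     ('a \<Rightarrow> 'e) \<Rightarrow> bool" where
  "smooth_along_on A B G V \<longleftrightarrow>
     (\<forall>c\<in>A. \<forall>d\<in>B. smooth_on (cmap d ` (cdom d \<inter> cdom c \<inter> G))
        (\<lambda>y. vec_to A c (cinv d y) (V (cinv d y))))"

text \<open>The ambient connection applied to a field \<open>V\<close> along the submanifold, in direction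
  \<open>w \<in> T\<^sub>xN\<close>. In the ambient chart \<open>c\<close> with coordinate fields \<open>\<partial>\<^sub>j\<close> and \<open>V = \<Sum>\<^sub>j V\<^sup>j \<partial>\<^sub>j\<close> this is
  \<open>\<Sum>\<^sub>j (w V\<^sup>j) \<partial>\<^sub>j + V\<^sup>j(x) \<nabla>\<^sub>w \<partial>\<^sub>j\<close>; the field to which \<open>nab\<close> is applied is the one with constant
  components \<open>V\<^sup>j(x)\<close> in \<open>c\<close>.\<close>

definition cov_along ::
    "('a, 'e::euclidean_space) chart set \<Rightarrow> ('a, 'f::euclidean_space) chart set \<Rightarrow>
     (('a \<Rightarrow> 'e) \<Rightarrow> 'a \<Rightarrow> 'e \<Rightarrow> 'e) \<Rightarrow> ('a \<Rightarrow> 'e) \<Rightarrow> 'a \<Rightarrow> 'f \<Rightarrow> 'e" where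
  "cov_along A B nab V x w =
     (let c = chart_at A x; d = chart_at B x
      in frechet_derivative (\<lambda>y. vec_to A c (cinv d y) (V (cinv d y))) (at (cmap d x)) w
           + nab (\<lambda>y. vec_from A c y (V x)) x (dincl A B x w))"

definition normal_space ::
    "('a, 'e::euclidean_space) chart set \<Rightarrow> ('a \<Rightarrow> 'e \<Rightarrow> 'e \<Rightarrow> real) \<Rightarrow>
     ('a, 'f::euclidean_space) chart set \<Rightarrow> 'a \<Rightarrow> 'e set" where
  "normal_space A g B x = {v. \<forall>w. g x v (dincl A B x w) = 0}"

definition Rad ::
    "('a, 'e::euclidean_space) chart set \<Rightarrow> ('a \<Rightarrow> 'e \<Rightarrow> 'e \<Rightarrow> real) \<Rightarrow>
     ('a, 'f::euclidean_space) chart set \<Rightarrow> 'a \<Rightarrow> 'f set" where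
  "Rad A g B x = {w. dincl A B x w \<in> normal_space A g B x}"


section \<open>Lightlike submanifolds and their bundles\<close>

text \<open>The argument \<open>sm\<close> is the notion of smooth local section of the surrounding bundle
  (\<open>smooth_vf_on B\<close> or \<open>smooth_along_on A B\<close>).\<close>

definition local_frame ::
    "('a set \<Rightarrow> ('a \<Rightarrow> 'v::euclidean_space) \<Rightarrow> bool) \<Rightarrow> 'a set \<Rightarrow> nat \<Rightarrow> (nat \<Rightarrow> 'a \<Rightarrow> 'v) \<Rightarrow>
     ('a \<Rightarrow> 'v set) \<Rightarrow> bool" where
  "local_frame sm G k X E \<longleftrightarrow>
     (\<forall>i<k. sm G (X i)) \<and>
     (\<forall>y\<in>G. inj_on (\<lambda>i. X i y) {..<k} \<and> independent ((\<lambda>i. X i y) ` {..<k}) \<and>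
        span ((\<lambda>i. X i y) ` {..<k}) = E y)"

definition smooth_subbundle ::
    "('a, 'f::euclidean_space) chart set \<Rightarrow> ('a set \<Rightarrow> ('a \<Rightarrow> 'v::euclidean_space) \<Rightarrow> bool) \<Rightarrow>
     ('a \<Rightarrow> 'v set) \<Rightarrow> bool" where
  "smooth_subbundle B sm E \<longleftrightarrow>
     (\<forall>x\<in>carrier_of B. \<exists>G k X. openin (mtop B) G \<and> x \<in> G \<and> local_frame sm G k X E)"

definition direct_sum_of :: "'v::real_vector set \<Rightarrow> 'v set \<Rightarrow> 'v set \<Rightarrow> bool" where
  "direct_sum_of V E F \<longleftrightarrow>
     subspace E \<and> subspace F \<and> E \<inter> F = {0} \<and> V = {e + f | e f. e \<in> E \<and> f \<in> F}"

definition lightlike_submanifold ::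
    "('a, 'e::euclidean_space) chart set \<Rightarrow> ('a \<Rightarrow> 'e \<Rightarrow> 'e \<Rightarrow> real) \<Rightarrow>
     ('a, 'f::euclidean_space) chart set \<Rightarrow> nat \<Rightarrow> bool" where
  "lightlike_submanifold A g B r \<longleftrightarrow>
     submanifold A B \<and> 1 \<le> r \<and> r \<le> DIM('f) \<and>
     smooth_subbundle B (smooth_vf_on B) (Rad A g B) \<and>
     (\<forall>x\<in>carrier_of B. dim (Rad A g B x) = r)"

definition screen_distribution ::
    "('a, 'e::euclidean_space) chart set \<Rightarrow> ('a \<Rightarrow> 'e \<Rightarrow> 'e \<Rightarrow> real) \<Rightarrow>
     ('a, 'f::euclidean_space) chart set \<Rightarrow> ('a \<Rightarrow> 'f set) \<Rightarrow> bool" where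
  "screen_distribution A g B S \<longleftrightarrow>
     smooth_subbundle B (smooth_vf_on B) S \<and>
     (\<forall>x\<in>carrier_of B. direct_sum_of UNIV (Rad A g B x) (S x) \<and>
        nondegenerate_on (dincl A B x ` S x) (g x))"

definition screen_transversal_bundle ::
    "('a, 'e::euclidean_space) chart set \<Rightarrow> ('a \<Rightarrow> 'e \<Rightarrow> 'e \<Rightarrow> real) \<Rightarrow>
     ('a, 'f::euclidean_space) chart set \<Rightarrow> ('a \<Rightarrow> 'e set) \<Rightarrow> bool" where
  "screen_transversal_bundle A g B Sperp \<longleftrightarrow>
     smooth_subbundle B (smooth_along_on A B) Sperp \<and>
     (\<forall>x\<in>carrier_of B.
        direct_sum_of (normal_space A g B x) (dincl A B x ` Rad A g B x) (Sperp x) \<and>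
        nondegenerate_on (Sperp x) (g x))"

definition lightlike_transversal_bundle ::
    "('a, 'e::euclidean_space) chart set \<Rightarrow> ('a \<Rightarrow> 'e \<Rightarrow> 'e \<Rightarrow> real) \<Rightarrow>
     ('a, 'f::euclidean_space) chart set \<Rightarrow> ('a \<Rightarrow> 'f set) \<Rightarrow> ('a \<Rightarrow> 'e set) \<Rightarrow> ('a \<Rightarrow> 'e set) \<Rightarrow>
     bool" where
  "lightlike_transversal_bundle A g B S Sperp ltr \<longleftrightarrow>
     smooth_subbundle B (smooth_along_on A B) ltr \<and>
     (\<forall>x\<in>carrier_of B. \<forall>v\<in>ltr x.
        (\<forall>u\<in>S x. g x v (dincl A B x u) = 0) \<and> (\<forall>z\<in>Sperp x. g x v z = 0)) \<and>
     (\<forall>G k \<xi>. openin (mtop B) G \<and> local_frame (smooth_vf_on B) G k \<xi> (Rad A g B) \<longrightarrow>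
        (\<forall>x\<in>G. \<exists>G' N. openin (mtop B) G' \<and> x \<in> G' \<and> G' \<subseteq> G \<and>
           local_frame (smooth_along_on A B) G' k N ltr \<and>
           (\<forall>y\<in>G'. \<forall>i<k. \<forall>j<k.
              g y (dincl A B y (\<xi> i y)) (N j y) = (if i = j then 1 else 0) \<and>
              g y (N i y) (N j y) = 0)))"

definition radical_screen_transversal ::
    "('a, 'e::euclidean_space) chart set \<Rightarrow> ('a \<Rightarrow> 'e \<Rightarrow> 'e \<Rightarrow> real) \<Rightarrow> ('a \<Rightarrow> 'e \<Rightarrow> 'e) \<Rightarrow>
     ('a, 'f::euclidean_space) chart set \<Rightarrow> ('a \<Rightarrow> 'f set) \<Rightarrow> ('a \<Rightarrow> 'e set) \<Rightarrow> bool" where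
  "radical_screen_transversal A g J B S Sperp \<longleftrightarrow>
     (\<forall>x\<in>carrier_of B.
        J x ` dincl A B x ` Rad A g B x \<subseteq> Sperp x \<and>
        J x ` dincl A B x ` S x = dincl A B x ` S x)"


section \<open>Induced objects\<close>

text \<open>The component in \<open>T\<^sub>xN\<close> of \<open>v \<in> T\<^sub>xM\<close> along \<open>ltr \<oplus> S(TN\<^sup>\<bottom>)\<close>.\<close>

definition tangent_part ::
    "('a, 'e::euclidean_space) chart set \<Rightarrow> ('a, 'f::euclidean_space) chart set \<Rightarrow>
     ('a \<Rightarrow> 'e set) \<Rightarrow> ('a \<Rightarrow> 'e set) \<Rightarrow> 'a \<Rightarrow> 'e \<Rightarrow> 'f" where
  "tangent_part A B Sperp ltr x v =
     (THE t. \<exists>l\<in>ltr x. \<exists>s\<in>Sperp x. v = dincl A B x t + l + s)"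

text \<open>\<open>(\<nabla>\<^sub>W U)(x)\<close>, from the Gauss formula.\<close>

definition induced_conn ::
    "('a, 'e::euclidean_space) chart set \<Rightarrow> ('a, 'f::euclidean_space) chart set \<Rightarrow>
     (('a \<Rightarrow> 'e) \<Rightarrow> 'a \<Rightarrow> 'e \<Rightarrow> 'e) \<Rightarrow> ('a \<Rightarrow> 'e set) \<Rightarrow> ('a \<Rightarrow> 'e set) \<Rightarrow>
     ('a \<Rightarrow> 'f) \<Rightarrow> ('a \<Rightarrow> 'f) \<Rightarrow> 'a \<Rightarrow> 'f" where
  "induced_conn A B nab Sperp ltr W U x =
     tangent_part A B Sperp ltr x (cov_along A B nab (\<lambda>y. dincl A B y (U y)) x (W x))"

text \<open>\<open>(A\<^sub>Z W)(x)\<close> for a section \<open>Z\<close> of the screen transversal bundle, from the Weingarten formula.\<close>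

definition shape_op ::
    "('a, 'e::euclidean_space) chart set \<Rightarrow> ('a, 'f::euclidean_space) chart set \<Rightarrow>
     (('a \<Rightarrow> 'e) \<Rightarrow> 'a \<Rightarrow> 'e \<Rightarrow> 'e) \<Rightarrow> ('a \<Rightarrow> 'e set) \<Rightarrow> ('a \<Rightarrow> 'e set) \<Rightarrow>
     ('a \<Rightarrow> 'e) \<Rightarrow> ('a \<Rightarrow> 'f) \<Rightarrow> 'a \<Rightarrow> 'f" where
  "shape_op A B nab Sperp ltr Z W x =
     - tangent_part A B Sperp ltr x (cov_along A B nab Z x (W x))"

text \<open>\<open>(A\<^sup>*\<^sub>\<xi> W)(x)\<close>: minus the \<open>S(TN)\<close>-component of \<open>\<nabla>\<^sub>W \<xi>\<close> along \<open>Rad(TN)\<close>.\<close>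

definition screen_shape_op ::
    "('a, 'e::euclidean_space) chart set \<Rightarrow> ('a \<Rightarrow> 'e \<Rightarrow> 'e \<Rightarrow> real) \<Rightarrow>
     ('a, 'f::euclidean_space) chart set \<Rightarrow>
     (('a \<Rightarrow> 'e) \<Rightarrow> 'a \<Rightarrow> 'e \<Rightarrow> 'e) \<Rightarrow> ('a \<Rightarrow> 'f set) \<Rightarrow> ('a \<Rightarrow> 'e set) \<Rightarrow> ('a \<Rightarrow> 'e set) \<Rightarrow>
     ('a \<Rightarrow> 'f) \<Rightarrow> ('a \<Rightarrow> 'f) \<Rightarrow> 'a \<Rightarrow> 'f" where
  "screen_shape_op A g B nab S Sperp ltr \<xi> W x =
     - (THE s. s \<in> S x \<and>
          (\<exists>t\<in>Rad A g B x. induced_conn A B nab Sperp ltr W \<xi> x = s + t))"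

definition tangent_sections ::
    "('a, 'f::euclidean_space) chart set \<Rightarrow> ('a \<Rightarrow> 'f set) \<Rightarrow> ('a \<Rightarrow> 'f) set" where
  "tangent_sections B E =
     {W. smooth_vf_on B (carrier_of B) W \<and> (\<forall>x\<in>carrier_of B. W x \<in> E x)}"

text \<open>A distribution \<open>E\<close> is integrable if \<open>\<Gamma>(E)\<close> is closed under the Lie bracket. The bracket of
  smooth fields is always smooth, so only the pointwise condition is required.\<close>

definition integrable_distribution ::
    "('a, 'f::euclidean_space) chart set \<Rightarrow> ('a \<Rightarrow> 'f set) \<Rightarrow> bool" where
  "integrable_distribution B E \<longleftrightarrow>
     (\<forall>W\<in>tangent_sections B E. \<forall>U\<in>tangent_sections B E.
        \<forall>x\<in>carrier_of B. lie_bracket B W U x \<in> E x)"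

definition J_along ::
    "('a, 'e::euclidean_space) chart set \<Rightarrow> ('a, 'f::euclidean_space) chart set \<Rightarrow>
     ('a \<Rightarrow> 'e \<Rightarrow> 'e) \<Rightarrow> ('a \<Rightarrow> 'f) \<Rightarrow> 'a \<Rightarrow> 'e" where
  "J_along A B J W x = J x (dincl A B x (W x))"

end

theory Submission
  imports Defs
begin

text \<open>Write \<open>i\<close> for the inclusion. For sections \<open>W\<close>, \<open>U\<close> of the radical distribution both sides of
  the claimed conditions depend only on the bracket \<open>b = [W, U]\<close>:

  \<^item> the ambient connection is torsion-free, so
    \<open>\<nabla>\<^sub>W (i U) - \<nabla>\<^sub>U (i W) = i b\<close> along the submanifold (lemma \<open>cov_along_torsion_free\<close>); hence
    \<open>A\<^sup>*\<^sub>W U - A\<^sup>*\<^sub>U W\<close> is the screen component of \<open>b\<close>;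
  \<^item> \<open>J\<close> is parallel, so \<open>\<nabla>\<^sub>W (J i U) = J \<nabla>\<^sub>W (i U)\<close> (lemma \<open>cov_along_parallel\<close>); hence
    \<open>A\<^bsub>J W\<^esub> U - A\<^bsub>J U\<^esub> W\<close> is the tangential part of \<open>J (i b)\<close>.

  The rest is linear algebra at one point. Write \<open>b = s + t\<close> with \<open>s\<close> in the screen and \<open>t\<close> in the
  radical. Since \<open>J\<close> maps the radical into the screen transversal bundle and preserves the screen,
  the tangential part of \<open>J (i b)\<close> is \<open>J s\<close>. If \<open>b\<close> is radical, then \<open>s = 0\<close> and
  both parts vanish, which gives (b). Conversely, (b) says in particular that \<open>s = 0\<close>, and (a) says
  that \<open>J s = p s\<close>; as \<open>J\<^sup>2 = p J + q\<close> this forces \<open>q s = 0\<close>, so again \<open>s = 0\<close> and \<open>b\<close> is radical.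

  The analytic work consists in proving the two facts about the covariant derivative along the
  submanifold from its expression in charts. The first one rests on the
  symmetry of second derivatives of the inclusion, the second one on the Leibniz rule for the
  coordinate expression of \<open>J\<close>.\<close>

section \<open>Calculus of smooth maps on open sets\<close>

lemma frechet_derivative_apply:
  "(f has_derivative f') (at x) \<Longrightarrow> frechet_derivative f (at x) v = f' v"
  using frechet_derivative_at by metis

lemma Ck_on_cong:
  assumes "open S" "\<And>x. x \<in> S \<Longrightarrow> f x = g x" "Ck_on k S f"
  shows "Ck_on k S g"
  using assms(2,3)
proof (induction k arbitrary: f g)
  case 0
  then show ?case by (auto cong: continuous_on_cong)
next
  case (Suc k)
  have d: "(g has_derivative frechet_derivative f (at x)) (at x)" if "x \<in> S" for x
    using has_derivative_transform_within_open[of f "frechet_derivative f (at x)" x UNIV S g]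
      Suc.prems that \<open>open S\<close> by (auto simp: frechet_derivative_works[symmetric])
  have e: "frechet_derivative g (at x) = frechet_derivative f (at x)" if "x \<in> S" for x
    using frechet_derivative_at[OF d[OF that]] by simp
  show ?case
    using Suc.prems(2) d Suc.IH[of "\<lambda>x. frechet_derivative f (at x) v" "\<lambda>x. frechet_derivative g (at x) v" for v]
    by (auto simp: e differentiable_def)
qed

lemma Ck_on_subset: "Ck_on k S f \<Longrightarrow> T \<subseteq> S \<Longrightarrow> Ck_on k T f"
  by (induction k arbitrary: f) (auto intro: continuous_on_subset)

lemma Ck_on_Suc_D: "Ck_on (Suc k) S f \<Longrightarrow> Ck_on k S f"
proof (induction k arbitrary: f)
  case 0
  then show ?case
    by (auto intro!: continuous_at_imp_continuous_on differentiable_imp_continuous_within)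
qed auto

lemma Ck_on_const: "Ck_on k S (\<lambda>x. c)"
  by (induction k arbitrary: c) auto

lemma Ck_on_bounded_linear:
  assumes L: "bounded_linear L" and "open S" "Ck_on k S f"
  shows "Ck_on k S (\<lambda>x. L (f x))"
  using assms(3)
proof (induction k arbitrary: f)
  case 0
  then show ?case using L by (auto intro: bounded_linear.continuous_on)
next
  case (Suc k)
  have d: "((\<lambda>x. L (f x)) has_derivative (\<lambda>v. L (frechet_derivative f (at x) v))) (at x)"
    if "x \<in> S" for x
    using Suc.prems that
    by (auto intro!: bounded_linear.has_derivative[OF L] simp: frechet_derivative_works[symmetric])
  have e: "frechet_derivative (\<lambda>x. L (f x)) (at x) v = L (frechet_derivative f (at x) v)"
    if "x \<in> S" for x v
    by (rule frechet_derivative_apply[OF d[OF that]])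
  have "Ck_on k S (\<lambda>x. frechet_derivative (\<lambda>x. L (f x)) (at x) v)" for v
    using Ck_on_cong[OF \<open>open S\<close> _ Suc.IH[of "\<lambda>x. frechet_derivative f (at x) v"]] Suc.prems
    by (auto simp: e)
  with d show ?case by (auto simp: differentiable_def)
qed

lemma Ck_on_add:
  assumes "open S" "Ck_on k S f" "Ck_on k S g"
  shows "Ck_on k S (\<lambda>x. f x + g x)"
  using assms(2,3)
proof (induction k arbitrary: f g)
  case 0
  then show ?case by (auto intro: continuous_on_add)
next
  case (Suc k)
  have d: "((\<lambda>x. f x + g x) has_derivative
      (\<lambda>v. frechet_derivative f (at x) v + frechet_derivative g (at x) v)) (at x)"
    if "x \<in> S" for x
    using Suc.prems that
    by (auto intro!: has_derivative_add simp: frechet_derivative_works[symmetric])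
  have e: "frechet_derivative (\<lambda>x. f x + g x) (at x) v
      = frechet_derivative f (at x) v + frechet_derivative g (at x) v"
    if "x \<in> S" for x v
    by (rule frechet_derivative_apply[OF d[OF that]])
  have "Ck_on k S (\<lambda>x. frechet_derivative (\<lambda>x. f x + g x) (at x) v)" for v
    by (rule Ck_on_cong[OF \<open>open S\<close> _ Suc.IH[of "\<lambda>x. frechet_derivative f (at x) v"
            "\<lambda>x. frechet_derivative g (at x) v"]])
      (use Suc.prems in \<open>auto simp: e\<close>)
  with d show ?case by (auto simp: differentiable_def)
qed

lemma Ck_on_sum:
  assumes "open S" "\<And>i. i \<in> I \<Longrightarrow> Ck_on k S (f i)"
  shows "Ck_on k S (\<lambda>x. \<Sum>i\<in>I. f i x)"
  using assms by (induction I rule: infinite_finite_induct) (auto intro: Ck_on_const Ck_on_add)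

lemma Ck_on_scaleR:
  fixes f :: "'e::euclidean_space \<Rightarrow> real"
  assumes "open S" "Ck_on k S f" "Ck_on k S g"
  shows "Ck_on k S (\<lambda>x. f x *\<^sub>R g x)"
  using assms(2,3)
proof (induction k arbitrary: f g)
  case 0
  then show ?case by (auto intro: continuous_on_scaleR)
next
  case (Suc k)
  have d: "((\<lambda>x. f x *\<^sub>R g x) has_derivative
      (\<lambda>v. f x *\<^sub>R frechet_derivative g (at x) v + frechet_derivative f (at x) v *\<^sub>R g x)) (at x)"
    if "x \<in> S" for x
    using Suc.prems that
    by (auto intro!: has_derivative_scaleR simp: frechet_derivative_works[symmetric])
  have e: "frechet_derivative (\<lambda>x. f x *\<^sub>R g x) (at x) v
      = f x *\<^sub>R frechet_derivative g (at x) v + frechet_derivative f (at x) v *\<^sub>R g x"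
    if "x \<in> S" for x v
    by (rule frechet_derivative_apply[OF d[OF that]])
  have "Ck_on k S (\<lambda>x. frechet_derivative (\<lambda>x. f x *\<^sub>R g x) (at x) v)" for v
  proof (rule Ck_on_cong[OF \<open>open S\<close>])
    show "Ck_on k S (\<lambda>x. f x *\<^sub>R frechet_derivative g (at x) v + frechet_derivative f (at x) v *\<^sub>R g x)"
      using Suc.prems Suc.prems[THEN Ck_on_Suc_D]
      by (intro Ck_on_add[OF \<open>open S\<close>] Suc.IH) auto
  qed (simp add: e)
  with d show ?case by (auto simp: differentiable_def)
qed

lemma linear_expand:
  fixes L :: "'e::euclidean_space \<Rightarrow> 'b::real_vector"
  assumes "linear L"
  shows "L u = (\<Sum>b\<in>Basis. (u \<bullet> b) *\<^sub>R L b)"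
proof -
  have "L u = L (\<Sum>b\<in>Basis. (u \<bullet> b) *\<^sub>R b)" by (simp add: euclidean_representation)
  also have "\<dots> = (\<Sum>b\<in>Basis. (u \<bullet> b) *\<^sub>R L b)"
    using assms by (simp add: linear_sum linear_cmul)
  finally show ?thesis .
qed

text \<open>A family \<open>\<Phi>\<close> of linear maps is \<open>C\<^sup>k\<close> as soon as each \<open>y \<mapsto> \<Phi> y e\<close> is, because the space of
  arguments has finite dimension. This form fits the definition of \<open>Ck_on\<close>, which speaks of
  directional derivatives only.\<close>

lemma Ck_on_linear_family:
  fixes u :: "'e::euclidean_space \<Rightarrow> 'b::euclidean_space"
  assumes "open S" "\<And>y. y \<in> S \<Longrightarrow> linear (\<Phi> y)" "\<And>e. Ck_on k S (\<lambda>y. \<Phi> y e)" "Ck_on k S u"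
  shows "Ck_on k S (\<lambda>y. \<Phi> y (u y))"
proof (rule Ck_on_cong[OF \<open>open S\<close>])
  show "Ck_on k S (\<lambda>y. \<Sum>b\<in>Basis. (u y \<bullet> b) *\<^sub>R \<Phi> y b)"
    using assms by (intro Ck_on_sum Ck_on_scaleR
        Ck_on_bounded_linear[OF bounded_linear_inner_left]) auto
qed (rule linear_expand[symmetric, OF assms(2)])

lemma linear_frechet_derivative:
  "f differentiable (at x) \<Longrightarrow> linear (frechet_derivative f (at x))"
  by (simp add: frechet_derivative_works has_derivative_linear)

lemma Ck_on_compose:
  fixes f :: "'e::euclidean_space \<Rightarrow> 'b::euclidean_space"
  assumes "open S" "Ck_on k S f" "Ck_on k T h" "f ` S \<subseteq> T"
  shows "Ck_on k S (\<lambda>x. h (f x))"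
  using assms(2,3)
proof (induction k arbitrary: h)
  case 0
  then show ?case using assms(4) continuous_on_compose2[of T h S f] by simp
next
  case (Suc k)
  have fd: "f differentiable (at x)" and hd: "h differentiable (at (f x))" if "x \<in> S" for x
    using Suc.prems that assms(4) by auto
  have d: "((\<lambda>x. h (f x)) has_derivative
      (\<lambda>v. frechet_derivative h (at (f x)) (frechet_derivative f (at x) v))) (at x)"
    if "x \<in> S" for x
    using has_derivative_compose[of f _ x UNIV h] fd[OF that] hd[OF that]
    by (simp add: frechet_derivative_works)
  have e: "frechet_derivative (\<lambda>x. h (f x)) (at x) v
      = frechet_derivative h (at (f x)) (frechet_derivative f (at x) v)"
    if "x \<in> S" for x v
    by (rule frechet_derivative_apply[OF d[OF that]])
  have "Ck_on k S (\<lambda>x. frechet_derivative (\<lambda>x. h (f x)) (at x) v)" for v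
  proof (rule Ck_on_cong[OF \<open>open S\<close>])
    show "Ck_on k S (\<lambda>x. frechet_derivative h (at (f x)) (frechet_derivative f (at x) v))"
    proof (rule Ck_on_linear_family[OF \<open>open S\<close>])
      show "linear (frechet_derivative h (at (f x)))" if "x \<in> S" for x
        by (rule linear_frechet_derivative[OF hd[OF that]])
      show "Ck_on k S (\<lambda>x. frechet_derivative h (at (f x)) e)" for e
        by (rule Suc.IH[of "\<lambda>y. frechet_derivative h (at y) e"])
          (use Suc.prems Ck_on_Suc_D[OF Suc.prems(1)] in auto)
      show "Ck_on k S (\<lambda>x. frechet_derivative f (at x) v)"
        using Suc.prems(1) by simp
    qed
  qed (simp add: e)
  with d show ?case by (auto simp: differentiable_def)
qed

lemma smooth_on_cong:
  "open S \<Longrightarrow> (\<And>x. x \<in> S \<Longrightarrow> f x = g x) \<Longrightarrow> smooth_on S f \<Longrightarrow> smooth_on S g"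
  unfolding smooth_on_def using Ck_on_cong by blast

lemma smooth_on_subset: "smooth_on S f \<Longrightarrow> T \<subseteq> S \<Longrightarrow> smooth_on T f"
  unfolding smooth_on_def using Ck_on_subset by blast

lemma smooth_on_const: "smooth_on S (\<lambda>x. c)"
  unfolding smooth_on_def using Ck_on_const by blast

lemma smooth_on_bounded_linear:
  "bounded_linear L \<Longrightarrow> open S \<Longrightarrow> smooth_on S f \<Longrightarrow> smooth_on S (\<lambda>x. L (f x))"
  unfolding smooth_on_def using Ck_on_bounded_linear by blast

lemma smooth_on_add:
  "open S \<Longrightarrow> smooth_on S f \<Longrightarrow> smooth_on S g \<Longrightarrow> smooth_on S (\<lambda>x. f x + g x)"
  unfolding smooth_on_def using Ck_on_add by blast

lemma smooth_on_sum:
  "open S \<Longrightarrow> (\<And>i. i \<in> I \<Longrightarrow> smooth_on S (f i)) \<Longrightarrow> smooth_on S (\<lambda>x. \<Sum>i\<in>I. f i x)"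
  unfolding smooth_on_def by (simp add: Ck_on_sum)

lemma smooth_on_linear_family:
  fixes u :: "'e::euclidean_space \<Rightarrow> 'b::euclidean_space"
  assumes "open S" "\<And>y. y \<in> S \<Longrightarrow> linear (\<Phi> y)" "\<And>e. smooth_on S (\<lambda>y. \<Phi> y e)" "smooth_on S u"
  shows "smooth_on S (\<lambda>y. \<Phi> y (u y))"
  using assms unfolding smooth_on_def by (blast intro: Ck_on_linear_family)

lemma smooth_on_compose:
  fixes f :: "'e::euclidean_space \<Rightarrow> 'b::euclidean_space"
  shows "open S \<Longrightarrow> smooth_on S f \<Longrightarrow> smooth_on T h \<Longrightarrow> f ` S \<subseteq> T \<Longrightarrow> smooth_on S (\<lambda>x. h (f x))"
  unfolding smooth_on_def using Ck_on_compose by blast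

lemma smooth_on_differentiable: "smooth_on S f \<Longrightarrow> x \<in> S \<Longrightarrow> f differentiable (at x)"
  unfolding smooth_on_def using Ck_on.simps(2) by blast

lemma smooth_on_frechet_derivative:
  "smooth_on S f \<Longrightarrow> smooth_on S (\<lambda>x. frechet_derivative f (at x) v)"
  unfolding smooth_on_def using Ck_on.simps(2) by blast

text \<open>The product rule for a family of linear maps applied to a variable vector; the map
  \<open>\<Phi>\<close> is only assumed to be differentiable pointwise in its second argument.\<close>

lemma has_derivative_linear_family:
  fixes u :: "'e::real_normed_vector \<Rightarrow> 'b::euclidean_space"
    and \<Phi> :: "'e \<Rightarrow> 'b \<Rightarrow> 'c::real_normed_vector"
  assumes S: "open S" "x \<in> S" and lin: "\<And>y. y \<in> S \<Longrightarrow> linear (\<Phi> y)"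
    and \<Phi>: "\<And>e. (\<lambda>y. \<Phi> y e) differentiable (at x)" and u: "u differentiable (at x)"
  shows "((\<lambda>y. \<Phi> y (u y)) has_derivative
    (\<lambda>w. frechet_derivative (\<lambda>y. \<Phi> y (u x)) (at x) w + \<Phi> x (frechet_derivative u (at x) w))) (at x)"
proof -
  define D where "D e = frechet_derivative (\<lambda>y. \<Phi> y e) (at x)" for e
  define Du where "Du = frechet_derivative u (at x)"
  have D: "((\<lambda>y. \<Phi> y e) has_derivative D e) (at x)" for e
    unfolding D_def using \<Phi> by (simp add: frechet_derivative_works)
  have Du: "(u has_derivative Du) (at x)"
    unfolding Du_def using u by (simp add: frechet_derivative_works)
  have "((\<lambda>y. \<Sum>b\<in>Basis. (u x \<bullet> b) *\<^sub>R \<Phi> y b) has_derivative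
      (\<lambda>w. \<Sum>b\<in>Basis. (u x \<bullet> b) *\<^sub>R D b w)) (at x)"
    by (intro has_derivative_sum has_derivative_scaleR_right D)
  then have "((\<lambda>y. \<Phi> y (u x)) has_derivative (\<lambda>w. \<Sum>b\<in>Basis. (u x \<bullet> b) *\<^sub>R D b w)) (at x)"
    by (rule has_derivative_transform_within_open[OF _ S]) (rule linear_expand[symmetric, OF lin])
  then have Dx: "D (u x) = (\<lambda>w. \<Sum>b\<in>Basis. (u x \<bullet> b) *\<^sub>R D b w)"
    unfolding D_def by (rule frechet_derivative_at[symmetric])
  have "((\<lambda>y. \<Sum>b\<in>Basis. (u y \<bullet> b) *\<^sub>R \<Phi> y b) has_derivative
      (\<lambda>w. \<Sum>b\<in>Basis. (u x \<bullet> b) *\<^sub>R D b w + (Du w \<bullet> b) *\<^sub>R \<Phi> x b)) (at x)"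
    by (intro has_derivative_sum has_derivative_scaleR D has_derivative_inner_left Du)
  moreover have "(\<lambda>w. \<Sum>b\<in>Basis. (u x \<bullet> b) *\<^sub>R D b w + (Du w \<bullet> b) *\<^sub>R \<Phi> x b)
      = (\<lambda>w. D (u x) w + \<Phi> x (Du w))"
    by (simp add: Dx sum.distrib linear_expand[OF lin[OF S(2)], of "Du _"])
  ultimately have "((\<lambda>y. \<Sum>b\<in>Basis. (u y \<bullet> b) *\<^sub>R \<Phi> y b) has_derivative
      (\<lambda>w. D (u x) w + \<Phi> x (Du w))) (at x)" by simp
  then show ?thesis unfolding D_def Du_def
    by (rule has_derivative_transform_within_open[OF _ S]) (rule linear_expand[symmetric, OF lin])
qed

text \<open>The second difference quotient of \<open>f\<close> in the directions \<open>v\<close>, \<open>w\<close> tends to the derivative in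
  direction \<open>w\<close> of the derivative in direction \<open>v\<close>. It does not change when \<open>v\<close> and \<open>w\<close> are
  exchanged, whence the symmetry of second derivatives.\<close>

lemma second_difference_tendsto:
  fixes f :: "'e::real_normed_vector \<Rightarrow> real"
  assumes S: "open S" "x \<in> S" and f: "\<And>y. y \<in> S \<Longrightarrow> (f has_derivative f' y) (at y)"
    and L: "((\<lambda>y. f' y v) has_derivative L) (at x)"
  shows "((\<lambda>t. (f (x + t *\<^sub>R v + t *\<^sub>R w) - f (x + t *\<^sub>R v) - f (x + t *\<^sub>R w) + f x) / t\<^sup>2)
      \<longlongrightarrow> L w) (at_right 0)"
proof (rule tendstoI)
  fix e :: real assume "e > 0"
  define N where "N = norm v + norm w + 1"
  have N: "N > 0" by (simp add: N_def add_nonneg_pos)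
  define \<epsilon> where "\<epsilon> = e / (4 * N)"
  have \<epsilon>: "\<epsilon> > 0" using \<open>e > 0\<close> N by (simp add: \<epsilon>_def)
  obtain d1 where d1: "d1 > 0" "\<And>y. norm (y - x) < d1 \<Longrightarrow>
      norm (f' y v - f' x v - L (y - x)) \<le> \<epsilon> * norm (y - x)"
    using L \<epsilon> unfolding has_derivative_at_alt by blast
  obtain d2 where d2: "d2 > 0" "ball x d2 \<subseteq> S" using S open_contains_ball by blast
  define d where "d = min d1 d2 / N"
  have d: "d > 0" using d1(1) d2(1) N by (simp add: d_def)
  have lL: "linear L" using L has_derivative_linear by blast
  have "dist ((f (x + t *\<^sub>R v + t *\<^sub>R w) - f (x + t *\<^sub>R v) - f (x + t *\<^sub>R w) + f x) / t\<^sup>2) (L w) < e"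
    if t: "0 < t" "t < d" for t
  proof -
    have tN: "t * N < d1" "t * N < d2" using t N by (auto simp: d_def field_simps)
    have small: "norm (s *\<^sub>R v + t' *\<^sub>R w) \<le> t * N" if "0 \<le> s" "s \<le> t" "0 \<le> t'" "t' \<le> t" for s t'
    proof -
      have "norm (s *\<^sub>R v + t' *\<^sub>R w) \<le> s * norm v + t' * norm w"
        using norm_triangle_ineq[of "s *\<^sub>R v" "t' *\<^sub>R w"] that by simp
      also have "\<dots> \<le> t * norm v + t * norm w"
        using that by (intro add_mono mult_right_mono) auto
      also have "\<dots> \<le> t * N" using t by (simp add: N_def algebra_simps)
      finally show ?thesis .
    qed
    have inS: "x + s *\<^sub>R v + t' *\<^sub>R w \<in> S" if "0 \<le> s" "s \<le> t" "0 \<le> t'" "t' \<le> t" for s t'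
    proof -
      have "norm (s *\<^sub>R v + t' *\<^sub>R w) < d2" using small[OF that] tN by linarith
      moreover have "dist x (x + h) = norm h" for h by (simp add: dist_norm)
      ultimately have "x + (s *\<^sub>R v + t' *\<^sub>R w) \<in> ball x d2" by simp
      then show ?thesis using d2(2) by (auto simp: add.assoc)
    qed
    have line: "DERIV (\<lambda>s. f (x + s *\<^sub>R v + t' *\<^sub>R w)) s :> f' (x + s *\<^sub>R v + t' *\<^sub>R w) v"
      if "0 \<le> s" "s \<le> t" "0 \<le> t'" "t' \<le> t" for s t'
    proof -
      have i: "((\<lambda>s. x + s *\<^sub>R v + t' *\<^sub>R w) has_derivative (\<lambda>h. h *\<^sub>R v)) (at s)"
        by (auto intro!: derivative_eq_intros)
      have "((\<lambda>s. f (x + s *\<^sub>R v + t' *\<^sub>R w)) has_derivative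
          (\<lambda>h. f' (x + s *\<^sub>R v + t' *\<^sub>R w) (h *\<^sub>R v))) (at s)"
        by (rule has_derivative_compose[OF i f[OF inS[OF that]]])
      moreover have "linear (f' (x + s *\<^sub>R v + t' *\<^sub>R w))"
        using f[OF inS[OF that]] has_derivative_linear by blast
      ultimately show ?thesis
        by (simp add: has_field_derivative_def linear_cmul mult.commute[of _ "f' _ v"])
    qed
    \<comment> \<open>The mean value theorem for \<open>s \<mapsto> f (x + s v + t w) - f (x + s v)\<close> on \<open>[0, t]\<close>.\<close>
    have "\<exists>s>0. s < t \<and>
        (f (x + t *\<^sub>R v + t *\<^sub>R w) - f (x + t *\<^sub>R v + 0 *\<^sub>R w)) -
        (f (x + 0 *\<^sub>R v + t *\<^sub>R w) - f (x + 0 *\<^sub>R v + 0 *\<^sub>R w)) =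
        (t - 0) * (f' (x + s *\<^sub>R v + t *\<^sub>R w) v - f' (x + s *\<^sub>R v + 0 *\<^sub>R w) v)"
      by (rule MVT2[OF t(1)], intro DERIV_diff line) (use t in auto)
    then obtain s where s: "0 < s" "s < t" and eq:
      "f (x + t *\<^sub>R v + t *\<^sub>R w) - f (x + t *\<^sub>R v) - f (x + t *\<^sub>R w) + f x
        = t * (f' (x + s *\<^sub>R v + t *\<^sub>R w) v - f' (x + s *\<^sub>R v) v)"
      by (auto simp: algebra_simps)
    have r: "\<bar>f' (x + s *\<^sub>R v + t' *\<^sub>R w) v - f' x v - L (s *\<^sub>R v + t' *\<^sub>R w)\<bar> \<le> \<epsilon> * (t * N)"
      if "0 \<le> t'" "t' \<le> t" for t'
    proof -
      have n: "norm (s *\<^sub>R v + t' *\<^sub>R w) \<le> t * N" using small that s by simp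
      have "\<bar>f' (x + s *\<^sub>R v + t' *\<^sub>R w) v - f' x v - L (s *\<^sub>R v + t' *\<^sub>R w)\<bar>
          \<le> \<epsilon> * norm (s *\<^sub>R v + t' *\<^sub>R w)"
        using d1(2)[of "x + s *\<^sub>R v + t' *\<^sub>R w"] n tN by (simp add: add.assoc)
      also have "\<dots> \<le> \<epsilon> * (t * N)" using n \<epsilon> by simp
      finally show ?thesis .
    qed
    have "L (s *\<^sub>R v + t *\<^sub>R w) - L (s *\<^sub>R v + 0 *\<^sub>R w) = t * L w"
      by (simp add: linear_add[OF lL] linear_cmul[OF lL])
    then have "\<bar>f' (x + s *\<^sub>R v + t *\<^sub>R w) v - f' (x + s *\<^sub>R v) v - t * L w\<bar> \<le> 2 * (\<epsilon> * (t * N))"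
      using r[of t] r[of 0] t by (simp add: abs_le_iff)
    also have "\<dots> < t * e" using t \<open>e > 0\<close> N by (simp add: \<epsilon>_def field_simps)
    finally have b: "\<bar>f' (x + s *\<^sub>R v + t *\<^sub>R w) v - f' (x + s *\<^sub>R v) v - t * L w\<bar> < t * e" .
    have "(f (x + t *\<^sub>R v + t *\<^sub>R w) - f (x + t *\<^sub>R v) - f (x + t *\<^sub>R w) + f x) / t\<^sup>2 - L w
        = (f' (x + s *\<^sub>R v + t *\<^sub>R w) v - f' (x + s *\<^sub>R v) v - t * L w) / t"
      using t unfolding eq by (simp add: power2_eq_square field_simps)
    also have "\<bar>\<dots>\<bar> < e" using b t by (simp add: abs_divide divide_less_eq mult.commute)
    finally show ?thesis by (simp add: dist_real_def)
  qed
  then show "\<forall>\<^sub>F t in at_right 0. dist ((f (x + t *\<^sub>R v + t *\<^sub>R w) - f (x + t *\<^sub>R v)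
      - f (x + t *\<^sub>R w) + f x) / t\<^sup>2) (L w) < e"
    unfolding eventually_at_right_field using d by blast
qed

lemma symmetric_second_derivative:
  fixes f :: "'e::euclidean_space \<Rightarrow> 'b::euclidean_space"
  assumes "open S" "x \<in> S" "smooth_on S f"
  shows "frechet_derivative (\<lambda>y. frechet_derivative f (at y) v) (at x) w
       = frechet_derivative (\<lambda>y. frechet_derivative f (at y) w) (at x) v"
proof (rule euclidean_eqI)
  fix b :: 'b assume "b \<in> Basis"
  let ?F = "\<lambda>y. f y \<bullet> b" and ?F' = "\<lambda>y v. frechet_derivative f (at y) v \<bullet> b"
  let ?L = "\<lambda>v w. frechet_derivative (\<lambda>y. frechet_derivative f (at y) v) (at x) w \<bullet> b"
  have 1: "(?F has_derivative ?F' y) (at y)" if "y \<in> S" for y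
    using smooth_on_differentiable[OF assms(3) that]
    by (auto intro!: has_derivative_inner_left simp: frechet_derivative_works)
  have 2: "((\<lambda>y. ?F' y v) has_derivative ?L v) (at x)" for v
    using smooth_on_differentiable[OF smooth_on_frechet_derivative[OF assms(3)] assms(2)]
    by (auto intro!: has_derivative_inner_left simp: frechet_derivative_works)
  have a: "x + t *\<^sub>R v + t *\<^sub>R w = x + t *\<^sub>R w + t *\<^sub>R v" for t by simp
  have "((\<lambda>t. (?F (x + t *\<^sub>R w + t *\<^sub>R v) - ?F (x + t *\<^sub>R w) - ?F (x + t *\<^sub>R v) + ?F x) / t\<^sup>2)
      \<longlongrightarrow> ?L v w) (at_right 0)"
    using second_difference_tendsto[OF assms(1,2) 1 2, of v w]
    unfolding a by (simp add: algebra_simps)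
  with second_difference_tendsto[OF assms(1,2) 1 2, of w v] show "?L v w = ?L w v"
    by (intro tendsto_unique[OF trivial_limit_at_right_real])
qed

section \<open>Differentials of changes of charts\<close>

text \<open>The differential at the point \<open>z\<close> of the change of coordinates from \<open>c\<close> to \<open>d\<close>. The two
  charts may belong to manifolds of different dimensions.\<close>

abbreviation chart_diff ::
    "('a, 'f::euclidean_space) chart \<Rightarrow> ('a, 'e::euclidean_space) chart \<Rightarrow> 'a \<Rightarrow> 'f \<Rightarrow> 'e" where
  "chart_diff c d z \<equiv> frechet_derivative (\<lambda>y. cmap d (cinv c y)) (at (cmap c z))"

text \<open>The chain rule for a function \<open>\<phi>\<close> on points, read in two charts.\<close>

lemma has_derivative_change_of_chart:
  fixes c :: "('a, 'f::euclidean_space) chart" and d :: "('a, 'e::euclidean_space) chart"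
    and \<phi> :: "'a \<Rightarrow> 'b::real_normed_vector"
  assumes c: "inj_on (cmap c) (cdom c)" and d: "inj_on (cmap d) (cdom d)"
    and op: "open (cmap c ` (cdom c \<inter> cdom d))" and z: "z \<in> cdom c" "z \<in> cdom d"
    and cd: "(\<lambda>y. cmap d (cinv c y)) differentiable (at (cmap c z))"
    and \<phi>: "(\<lambda>y. \<phi> (cinv d y)) differentiable (at (cmap d z))"
  shows "((\<lambda>y. \<phi> (cinv c y)) has_derivative
    (\<lambda>v. frechet_derivative (\<lambda>y. \<phi> (cinv d y)) (at (cmap d z)) (chart_diff c d z v))) (at (cmap c z))"
proof (rule has_derivative_transform_within_open[OF _ op])
  have "cmap d (cinv c (cmap c z)) = cmap d z" using c z by simp
  then show "((\<lambda>y. \<phi> (cinv d (cmap d (cinv c y)))) has_derivative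
    (\<lambda>v. frechet_derivative (\<lambda>y. \<phi> (cinv d y)) (at (cmap d z)) (chart_diff c d z v))) (at (cmap c z))"
    using has_derivative_compose[of "\<lambda>y. cmap d (cinv c y)" "chart_diff c d z" "cmap c z" UNIV
        "\<lambda>y. \<phi> (cinv d y)" "frechet_derivative (\<lambda>y. \<phi> (cinv d y)) (at (cmap d z))"] cd \<phi>
    by (simp add: frechet_derivative_works)
  show "cmap c z \<in> cmap c ` (cdom c \<inter> cdom d)" using z by simp
  show "\<phi> (cinv d (cmap d (cinv c y))) = \<phi> (cinv c y)" if "y \<in> cmap c ` (cdom c \<inter> cdom d)" for y
    using that c d by auto
qed

lemma chart_diff_self:
  assumes "inj_on (cmap c) (cdom c)" "open (cmap c ` cdom c)" "z \<in> cdom c"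
  shows "chart_diff c c z v = v"
proof -
  have "((\<lambda>y. cmap c (cinv c y)) has_derivative (\<lambda>v. v)) (at (cmap c z))"
    by (rule has_derivative_transform_within_open[OF has_derivative_ident assms(2)])
      (use assms in auto)
  then show ?thesis by (rule frechet_derivative_apply)
qed

lemma smooth_manifold_chart:
  assumes "smooth_manifold A" "c \<in> A"
  shows "inj_on (cmap c) (cdom c)" "open (cmap c ` cdom c)"
  using assms unfolding smooth_manifold_def by auto

lemma smooth_manifold_transition:
  assumes "smooth_manifold A" "c \<in> A" "d \<in> A"
  shows "open (cmap c ` (cdom c \<inter> cdom d))"
    "smooth_on (cmap c ` (cdom c \<inter> cdom d)) (\<lambda>y. cmap d (cinv c y))"
    "z \<in> cdom c \<Longrightarrow> z \<in> cdom d \<Longrightarrow> (\<lambda>y. cmap d (cinv c y)) differentiable (at (cmap c z))"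
proof -
  show *: "open (cmap c ` (cdom c \<inter> cdom d))"
    "smooth_on (cmap c ` (cdom c \<inter> cdom d)) (\<lambda>y. cmap d (cinv c y))"
    using assms unfolding smooth_manifold_def by auto
  show "z \<in> cdom c \<Longrightarrow> z \<in> cdom d \<Longrightarrow> (\<lambda>y. cmap d (cinv c y)) differentiable (at (cmap c z))"
    using smooth_on_differentiable[OF *(2)] by auto
qed

lemma chart_at:
  assumes "x \<in> carrier_of A"
  shows "chart_at A x \<in> A" "x \<in> cdom (chart_at A x)"
proof -
  have "\<exists>c. c \<in> A \<and> x \<in> cdom c" using assms by (auto simp: carrier_of_def)
  then have "chart_at A x \<in> A \<and> x \<in> cdom (chart_at A x)" unfolding chart_at_def by (rule someI_ex)
  then show "chart_at A x \<in> A" "x \<in> cdom (chart_at A x)" by auto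
qed

lemma cdom_carrier: "c \<in> A \<Longrightarrow> x \<in> cdom c \<Longrightarrow> x \<in> carrier_of A"
  by (auto simp: carrier_of_def)

lemma submanifoldD:
  assumes "submanifold A B"
  shows "smooth_manifold A" "smooth_manifold B" "carrier_of B \<subseteq> carrier_of A"
    "x \<in> carrier_of B \<Longrightarrow> inj (dincl A B x)"
  using assms unfolding submanifold_def by auto

lemma submanifold_transition:
  assumes "submanifold A B" "c \<in> A" "d \<in> B"
  shows "open (cmap d ` (cdom d \<inter> cdom c))"
    "smooth_on (cmap d ` (cdom d \<inter> cdom c)) (\<lambda>y. cmap c (cinv d y))"
    "z \<in> cdom c \<Longrightarrow> z \<in> cdom d \<Longrightarrow> (\<lambda>y. cmap c (cinv d y)) differentiable (at (cmap d z))"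
proof -
  show *: "open (cmap d ` (cdom d \<inter> cdom c))"
    "smooth_on (cmap d ` (cdom d \<inter> cdom c)) (\<lambda>y. cmap c (cinv d y))"
    using assms unfolding submanifold_def by auto
  show "z \<in> cdom c \<Longrightarrow> z \<in> cdom d \<Longrightarrow> (\<lambda>y. cmap c (cinv d y)) differentiable (at (cmap d z))"
    using smooth_on_differentiable[OF *(2)] by auto
qed

lemma chart_diff_compose:
  assumes "smooth_manifold A" "c \<in> A" "d \<in> A" "e \<in> A" "z \<in> cdom c" "z \<in> cdom d" "z \<in> cdom e"
  shows "chart_diff d e z (chart_diff c d z v) = chart_diff c e z v"
  by (rule frechet_derivative_apply[symmetric], rule has_derivative_change_of_chart)
    (use assms smooth_manifold_chart[OF assms(1)] smooth_manifold_transition[OF assms(1)] in auto)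

lemma linear_vec_to:
  assumes "smooth_manifold A" "c \<in> A" "x \<in> cdom c"
  shows "linear (vec_to A c x)"
  unfolding vec_to_def
  by (intro linear_frechet_derivative smooth_manifold_transition(3)[OF assms(1)] chart_at
      cdom_carrier[OF assms(2,3)] assms)

lemma linear_vec_from:
  assumes "smooth_manifold A" "c \<in> A" "x \<in> cdom c"
  shows "linear (vec_from A c x)"
  unfolding vec_from_def
  by (intro linear_frechet_derivative smooth_manifold_transition(3)[OF assms(1)] chart_at
      cdom_carrier[OF assms(2,3)] assms)

lemma vec_to_vec_from:
  assumes "smooth_manifold A" "c \<in> A" "d \<in> A" "x \<in> cdom c" "x \<in> cdom d"
  shows "vec_to A d x (vec_from A c x e) = chart_diff c d x e"
  unfolding vec_to_def vec_from_def
  using chart_diff_compose[OF assms(1,2) chart_at(1) assms(3,4) chart_at(2) assms(5)]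
    cdom_carrier[OF assms(2,4)] by simp

lemma vec_to_vec_from_same:
  assumes "smooth_manifold A" "c \<in> A" "x \<in> cdom c"
  shows "vec_to A c x (vec_from A c x e) = e"
  using vec_to_vec_from[OF assms(1,2,2,3,3)] chart_diff_self smooth_manifold_chart[OF assms(1,2)] assms(3)
  by simp

lemma vec_from_vec_to:
  assumes "smooth_manifold A" "c \<in> A" "x \<in> cdom c"
  shows "vec_from A c x (vec_to A c x v) = v"
proof -
  note ca = chart_at[OF cdom_carrier[OF assms(2,3)]]
  have "vec_from A c x (vec_to A c x v) = chart_diff (chart_at A x) (chart_at A x) x v"
    unfolding vec_to_def vec_from_def
    by (rule chart_diff_compose[OF assms(1) ca(1) assms(2) ca(1,2) assms(3) ca(2)])
  also have "\<dots> = v" using chart_diff_self smooth_manifold_chart[OF assms(1) ca(1)] ca(2) .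
  finally show ?thesis .
qed

lemma vec_to_chart_at:
  assumes "smooth_manifold A" "x \<in> carrier_of A"
  shows "vec_to A (chart_at A x) x v = v"
  unfolding vec_to_def
  by (rule chart_diff_self) (use smooth_manifold_chart[OF assms(1)] chart_at[OF assms(2)] in auto)

lemma vec_from_chart_at:
  assumes "smooth_manifold A" "x \<in> carrier_of A"
  shows "vec_from A (chart_at A x) x v = v"
  unfolding vec_from_def
  by (rule chart_diff_self) (use smooth_manifold_chart[OF assms(1)] chart_at[OF assms(2)] in auto)

lemma linear_dincl:
  assumes "submanifold A B" "x \<in> carrier_of B"
  shows "linear (dincl A B x)"
  unfolding dincl_def
  using assms submanifoldD(3)[OF assms(1)]
  by (intro linear_frechet_derivative submanifold_transition(3)[OF assms(1)] chart_at) auto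

text \<open>In arbitrary charts the differential of the inclusion is the differential of its
  coordinate expression.\<close>

lemma vec_to_dincl:
  assumes AB: "submanifold A B" and c: "c \<in> A" "x \<in> cdom c" and d: "d \<in> B" "x \<in> cdom d"
  shows "vec_to A c x (dincl A B x u) = chart_diff d c x (vec_to B d x u)"
proof -
  note M = submanifoldD(1,2)[OF AB]
  note ca = chart_at[OF cdom_carrier[OF c]] and da = chart_at[OF cdom_carrier[OF d]]
  note T = submanifold_transition[OF AB]
  have "vec_to A c x (dincl A B x u) = chart_diff (chart_at B x) c x u"
    unfolding vec_to_def dincl_def
    by (rule frechet_derivative_apply[symmetric], rule has_derivative_change_of_chart)
      (use ca da c smooth_manifold_chart(1)[OF M(1)] smooth_manifold_chart(1)[OF M(2)] T
        smooth_manifold_transition(3)[OF M(1)] in auto)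
  also have "\<dots> = chart_diff d c x (vec_to B d x u)"
    unfolding vec_to_def
    by (rule frechet_derivative_apply, rule has_derivative_change_of_chart)
      (use da c d smooth_manifold_chart(1)[OF M(2)] T
        smooth_manifold_transition[OF M(2)] in auto)
  finally show ?thesis .
qed

section \<open>Affine connections in a chart\<close>

lemma openin_cdom: "c \<in> A \<Longrightarrow> openin (mtop A) (cdom c)"
  unfolding mtop_def
  by (rule topology_generated_by_Basis, rule CollectI, rule exI[of _ c], rule exI[of _ UNIV]) simp

lemma smooth_on_change_of_chart:
  assumes M: "smooth_manifold A" and c: "c \<in> A" "d \<in> A"
    and h: "smooth_on (cmap c ` (cdom c \<inter> cdom d)) h"
  shows "smooth_on (cmap d ` (cdom d \<inter> cdom c)) (\<lambda>y. h (cmap c (cinv d y)))"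
proof (rule smooth_on_compose[OF _ _ h])
  show "open (cmap d ` (cdom d \<inter> cdom c))"
    "smooth_on (cmap d ` (cdom d \<inter> cdom c)) (\<lambda>y. cmap c (cinv d y))"
    using smooth_manifold_transition[OF M c(2,1)] by auto
  show "(\<lambda>y. cmap c (cinv d y)) ` cmap d ` (cdom d \<inter> cdom c) \<subseteq> cmap c ` (cdom c \<inter> cdom d)"
    using smooth_manifold_chart(1)[OF M c(2)] by auto
qed

lemma smooth_fun_on_chart:
  assumes M: "smooth_manifold A" and c: "c \<in> A"
    and f: "smooth_on (cmap c ` cdom c) (\<lambda>y. f (cinv c y))"
  shows "smooth_fun_on A (cdom c) f"
  unfolding smooth_fun_on_def
proof
  fix d assume d: "d \<in> A"
  have "smooth_on (cmap d ` (cdom d \<inter> cdom c)) (\<lambda>y. f (cinv c (cmap c (cinv d y))))"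
    using smooth_on_change_of_chart[OF M c d, of "\<lambda>y. f (cinv c y)"]
      smooth_on_subset[OF f, of "cmap c ` (cdom c \<inter> cdom d)"] by auto
  then show "smooth_on (cmap d ` (cdom d \<inter> cdom c)) (\<lambda>y. f (cinv d y))"
    by (rule smooth_on_cong[rotated 2])
      (use smooth_manifold_chart(1)[OF M] smooth_manifold_transition(1)[OF M] c d in auto)
qed

text \<open>A vector field on the domain of one chart is smooth in every chart if its components in
  the given one are.\<close>

lemma smooth_vf_on_chart:
  assumes M: "smooth_manifold A" and c: "c \<in> A"
    and F: "smooth_on (cmap c ` cdom c) (\<lambda>y. F (cinv c y))"
  shows "smooth_vf_on A (cdom c) (\<lambda>z. vec_from A c z (F z))"
  unfolding smooth_vf_on_def
proof
  fix d assume d: "d \<in> A"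
  let ?h = "\<lambda>y. frechet_derivative (\<lambda>y. cmap d (cinv c y)) (at y) (F (cinv c y))"
  let ?S = "cmap c ` (cdom c \<inter> cdom d)"
  note T = smooth_manifold_transition[OF M c d]
  have "smooth_on ?S ?h"
    by (rule smooth_on_linear_family[OF T(1)])
      (use T(2) smooth_on_differentiable[OF T(2)] smooth_on_subset[OF F, of ?S] in
        \<open>auto intro!: linear_frechet_derivative smooth_on_frechet_derivative\<close>)
  then have "smooth_on (cmap d ` (cdom d \<inter> cdom c)) (\<lambda>y. ?h (cmap c (cinv d y)))"
    by (rule smooth_on_change_of_chart[OF M c d])
  then show "smooth_on (cmap d ` (cdom d \<inter> cdom c))
      (\<lambda>y. vec_to A d (cinv d y) (vec_from A c (cinv d y) (F (cinv d y))))"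
  proof (rule smooth_on_cong[rotated 2])
    show "open (cmap d ` (cdom d \<inter> cdom c))" by (rule smooth_manifold_transition(1)[OF M d c])
    fix y assume "y \<in> cmap d ` (cdom d \<inter> cdom c)"
    then obtain z where z: "z \<in> cdom d" "z \<in> cdom c" "y = cmap d z" by auto
    then have "cinv d y = z" "cinv c (cmap c z) = z"
      using smooth_manifold_chart(1)[OF M] c d by auto
    then show "?h (cmap c (cinv d y)) = vec_to A d (cinv d y) (vec_from A c (cinv d y) (F (cinv d y)))"
      using vec_to_vec_from[OF M c d z(2,1)] by simp
  qed
qed

lemma affine_connectionD:
  assumes "affine_connection A nab" "openin (mtop A) G" "smooth_vf_on A G Y" "x \<in> G"
  shows affine_connection_local: "(\<And>y. y \<in> G \<Longrightarrow> Z y = Y y) \<Longrightarrow> nab Z x v = nab Y x v"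
    and affine_connection_add: "smooth_vf_on A G Z \<Longrightarrow>
      nab (\<lambda>y. Y y + Z y) x v = nab Y x v + nab Z x v"
    and affine_connection_scaleR: "smooth_fun_on A G f \<Longrightarrow>
      nab (\<lambda>y. f y *\<^sub>R Y y) x v = dir_deriv A f x v *\<^sub>R Y x + f x *\<^sub>R nab Y x v"
proof -
  note * = assms(1)[unfolded affine_connection_def, THEN spec, THEN spec, THEN mp,
      OF conjI[OF assms(2,3)], THEN conjunct2, THEN conjunct2]
  show "nab Z x v = nab Y x v" if "\<And>y. y \<in> G \<Longrightarrow> Z y = Y y"
    using *[THEN conjunct1, THEN spec, of Z] that assms(4) by blast
  show "nab (\<lambda>y. Y y + Z y) x v = nab Y x v + nab Z x v" if "smooth_vf_on A G Z"
    using *[THEN conjunct2, THEN conjunct1, THEN spec, of Z] that assms(4) by blast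
  show "nab (\<lambda>y. f y *\<^sub>R Y y) x v = dir_deriv A f x v *\<^sub>R Y x + f x *\<^sub>R nab Y x v"
    if "smooth_fun_on A G f"
    using *[THEN conjunct2, THEN conjunct2, THEN spec, of f] that assms(4) by blast
qed

lemma nab_chart_add:
  assumes M: "smooth_manifold A" and nab: "affine_connection A nab" and c: "c \<in> A" "x \<in> cdom c"
    and F: "smooth_on (cmap c ` cdom c) (\<lambda>y. F (cinv c y))"
    and H: "smooth_on (cmap c ` cdom c) (\<lambda>y. H (cinv c y))"
  shows "nab (\<lambda>y. vec_from A c y (F y + H y)) x v
    = nab (\<lambda>y. vec_from A c y (F y)) x v + nab (\<lambda>y. vec_from A c y (H y)) x v"
proof -
  note G = openin_cdom[OF c(1)]
  note sF = smooth_vf_on_chart[OF M c(1) F] and sH = smooth_vf_on_chart[OF M c(1) H]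
  have sFH: "smooth_vf_on A (cdom c) (\<lambda>y. vec_from A c y (F y + H y))"
    by (intro smooth_vf_on_chart[OF M c(1)] smooth_on_add F H smooth_manifold_chart(2)[OF M c(1)])
  have "nab (\<lambda>y. vec_from A c y (F y) + vec_from A c y (H y)) x v
      = nab (\<lambda>y. vec_from A c y (F y + H y)) x v"
    by (rule affine_connection_local[OF nab G sFH c(2)])
      (simp add: linear_add[OF linear_vec_from[OF M c(1)]])
  with affine_connection_add[OF nab G sF c(2) sH] show ?thesis by simp
qed

lemma nab_chart_sum:
  assumes M: "smooth_manifold A" and nab: "affine_connection A nab" and c: "c \<in> A" "x \<in> cdom c"
    and "finite I" and F: "\<And>i. i \<in> I \<Longrightarrow> smooth_on (cmap c ` cdom c) (\<lambda>y. F i (cinv c y))"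
  shows "nab (\<lambda>y. vec_from A c y (\<Sum>i\<in>I. F i y)) x v = (\<Sum>i\<in>I. nab (\<lambda>y. vec_from A c y (F i y)) x v)"
  using \<open>finite I\<close> F
proof (induction I)
  case empty
  \<comment> \<open>The zero field is its own double.\<close>
  show ?case
    using nab_chart_add[OF M nab c smooth_on_const[of _ 0] smooth_on_const[of _ 0]] by simp
next
  case (insert i I)
  then have "smooth_on (cmap c ` cdom c) (\<lambda>y. \<Sum>i\<in>I. F i (cinv c y))"
    by (intro smooth_on_sum smooth_manifold_chart(2)[OF M c(1)]) auto
  then show ?case
    using insert nab_chart_add[OF M nab c, of "F i" "\<lambda>y. \<Sum>i\<in>I. F i y" v] by simp
qed

text \<open>The coordinate expression of \<open>\<nabla>\<^sub>v Y\<close> for the field \<open>Y\<close> with components \<open>F\<close>: the derivative of the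
  components plus the derivative of the field with constant components \<open>F x\<close>. The last
  term stands for the Christoffel symbols.\<close>

lemma nab_chart:
  fixes A :: "('a, 'e::euclidean_space) chart set"
  assumes M: "smooth_manifold A" and nab: "affine_connection A nab" and x: "x \<in> carrier_of A"
    and c_def: "c = chart_at A x"
    and F: "smooth_on (cmap c ` cdom c) (\<lambda>y. F (cinv c y))"
  shows "nab (\<lambda>y. vec_from A c y (F y)) x v
    = frechet_derivative (\<lambda>y. F (cinv c y)) (at (cmap c x)) v + nab (\<lambda>y. vec_from A c y (F x)) x v"
proof -
  have c: "c \<in> A" "x \<in> cdom c" using chart_at[OF x] by (auto simp: c_def)
  note G = openin_cdom[OF c(1)] and opc = smooth_manifold_chart(2)[OF M c(1)]
  have *: "nab (\<lambda>y. vec_from A c y (F y)) x v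
      = frechet_derivative (\<lambda>y. F (cinv c y)) (at (cmap c x)) v
        + (\<Sum>b\<in>Basis. (F x \<bullet> b) *\<^sub>R nab (\<lambda>y. vec_from A c y b) x v)"
    if F: "smooth_on (cmap c ` cdom c) (\<lambda>y. F (cinv c y))" for F :: "'a \<Rightarrow> 'e"
  proof -
    have sm: "smooth_on (cmap c ` cdom c) (\<lambda>y. F (cinv c y) \<bullet> b)" for b
      by (rule smooth_on_bounded_linear[OF bounded_linear_inner_left opc F])
    have smb: "smooth_on (cmap c ` cdom c) (\<lambda>y. (F (cinv c y) \<bullet> b) *\<^sub>R b)" for b :: 'e
      by (rule smooth_on_bounded_linear[OF bounded_linear_scaleR_left opc sm])
    have dF: "dir_deriv A (\<lambda>y. F y \<bullet> b) x v = frechet_derivative (\<lambda>y. F (cinv c y)) (at (cmap c x)) v \<bullet> b"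
      for b
      unfolding dir_deriv_def c_def[symmetric]
      by (rule frechet_derivative_apply, rule has_derivative_inner_left)
        (use smooth_on_differentiable[OF F] c in \<open>auto simp: frechet_derivative_works\<close>)
    have "nab (\<lambda>y. vec_from A c y (F y)) x v
        = nab (\<lambda>y. vec_from A c y (\<Sum>b\<in>Basis. (F y \<bullet> b) *\<^sub>R b)) x v"
      by (simp add: euclidean_representation)
    also have "\<dots> = (\<Sum>b\<in>Basis. nab (\<lambda>y. vec_from A c y ((F y \<bullet> b) *\<^sub>R b)) x v)"
      by (rule nab_chart_sum[OF M nab c]) (use smb in auto)
    also have "\<dots> = (\<Sum>b\<in>Basis. (frechet_derivative (\<lambda>y. F (cinv c y)) (at (cmap c x)) v \<bullet> b) *\<^sub>R b
        + (F x \<bullet> b) *\<^sub>R nab (\<lambda>y. vec_from A c y b) x v)"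
    proof (rule sum.cong)
      fix b :: 'e assume "b \<in> Basis"
      have "nab (\<lambda>y. vec_from A c y ((F y \<bullet> b) *\<^sub>R b)) x v
          = nab (\<lambda>y. (F y \<bullet> b) *\<^sub>R vec_from A c y b) x v"
        by (rule affine_connection_local[OF nab G _ c(2), symmetric])
          (use smooth_vf_on_chart[OF M c(1) smb] in
            \<open>auto simp: linear_cmul[OF linear_vec_from[OF M c(1)]]\<close>)
      also have "\<dots> = (frechet_derivative (\<lambda>y. F (cinv c y)) (at (cmap c x)) v \<bullet> b) *\<^sub>R vec_from A c x b
          + (F x \<bullet> b) *\<^sub>R nab (\<lambda>y. vec_from A c y b) x v"
        unfolding dF[symmetric] by (rule affine_connection_scaleR[OF nab G _ c(2)])
          (intro smooth_vf_on_chart[OF M c(1)] smooth_fun_on_chart[OF M c(1)] smooth_on_const sm)+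
      finally show "nab (\<lambda>y. vec_from A c y ((F y \<bullet> b) *\<^sub>R b)) x v
          = (frechet_derivative (\<lambda>y. F (cinv c y)) (at (cmap c x)) v \<bullet> b) *\<^sub>R b
            + (F x \<bullet> b) *\<^sub>R nab (\<lambda>y. vec_from A c y b) x v"
        by (simp add: vec_from_chart_at[OF M x] c_def)
    qed simp
    finally show ?thesis by (simp add: sum.distrib euclidean_representation)
  qed
  show ?thesis
    using *[OF F] *[of "\<lambda>y. F x"] by (simp add: smooth_on_const)
qed

text \<open>Torsion-freeness for coordinate fields, whose brackets vanish.\<close>

lemma nab_coordinate_fields_commute:
  assumes M: "smooth_manifold A" and nab: "levi_civita A g nab" and x: "x \<in> carrier_of A"
    and c_def: "c = chart_at A x"
  shows "nab (\<lambda>y. vec_from A c y e) x e' = nab (\<lambda>y. vec_from A c y e') x e"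
proof -
  have c: "c \<in> A" "x \<in> cdom c" using chart_at[OF x] by (auto simp: c_def)
  have *: "frechet_derivative (\<lambda>y. vec_to A c (cinv c y) (vec_from A c (cinv c y) e)) (at (cmap c x)) v = 0"
    for e v
  proof (rule frechet_derivative_apply)
    show "((\<lambda>y. vec_to A c (cinv c y) (vec_from A c (cinv c y) e)) has_derivative (\<lambda>v. 0)) (at (cmap c x))"
      by (rule has_derivative_transform_within_open[OF has_derivative_const
            smooth_manifold_chart(2)[OF M c(1)]])
        (use smooth_manifold_chart(1)[OF M c(1)] vec_to_vec_from_same[OF M c(1)] c in auto)
  qed
  have "lie_bracket A (\<lambda>y. vec_from A c y e') (\<lambda>y. vec_from A c y e) x = 0"
    unfolding lie_bracket_def c_def[symmetric] by (simp add: *)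
  moreover have "smooth_vf_on A (cdom c) (\<lambda>y. vec_from A c y e)" for e
    by (rule smooth_vf_on_chart[OF M c(1) smooth_on_const])
  note nab[unfolded levi_civita_def, THEN conjunct2, THEN spec, THEN spec, THEN spec, THEN mp,
      OF conjI[OF openin_cdom[OF c(1)] conjI[OF this[of e'] this[of e]]], THEN conjunct1, THEN bspec, OF c(2)]
  ultimately have "nab (\<lambda>y. vec_from A c y e) x (vec_from A c x e')
      - nab (\<lambda>y. vec_from A c y e') x (vec_from A c x e) = 0"
    by simp
  then show ?thesis by (simp add: c_def vec_from_chart_at[OF M x])
qed

section \<open>The ambient connection along a submanifold\<close>

text \<open>The components of a tangent field \<open>i U\<close> are \<open>D\<tau> y (u y)\<close>, where \<open>\<tau>\<close> is the coordinate
  expression of the inclusion and \<open>u\<close> are the components of \<open>U\<close>; their derivative therefore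
  contains the second derivative of \<open>\<tau>\<close>.\<close>

lemma dincl_field_has_derivative:
  assumes AB: "submanifold A B" and x: "x \<in> carrier_of B"
    and U: "smooth_vf_on B (carrier_of B) U"
    and c_def: "c = chart_at A x" and d_def: "d = chart_at B x"
  shows "((\<lambda>y. vec_to A c (cinv d y) (dincl A B (cinv d y) (U (cinv d y)))) has_derivative
    (\<lambda>w. frechet_derivative (\<lambda>y. frechet_derivative (\<lambda>y. cmap c (cinv d y)) (at y) (U x)) (at (cmap d x)) w
       + dincl A B x (frechet_derivative (\<lambda>y. vec_to B d (cinv d y) (U (cinv d y))) (at (cmap d x)) w)))
    (at (cmap d x))"
proof -
  note M = submanifoldD(1,2)[OF AB]
  have c: "c \<in> A" "x \<in> cdom c" and d: "d \<in> B" "x \<in> cdom d"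
    using chart_at[of x] x submanifoldD(3)[OF AB] by (auto simp: c_def d_def)
  let ?S = "cmap d ` (cdom d \<inter> cdom c)" and ?u = "\<lambda>y. vec_to B d (cinv d y) (U (cinv d y))"
  note T = submanifold_transition[OF AB c(1) d(1)]
  have xS: "cmap d x \<in> ?S" using c d by auto
  have inv: "cinv d (cmap d x) = x" using smooth_manifold_chart(1)[OF M(2) d(1)] d by simp
  then have ux: "?u (cmap d x) = U x" by (simp add: vec_to_chart_at[OF M(2) x] d_def)
  have "cdom d \<inter> carrier_of B = cdom d" using cdom_carrier[OF d(1)] by auto
  then have "smooth_on (cmap d ` cdom d) ?u"
    using U[unfolded smooth_vf_on_def, THEN bspec, OF d(1)] by simp
  then have u: "?u differentiable (at (cmap d x))" using d smooth_on_differentiable by blast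
  have "((\<lambda>y. frechet_derivative (\<lambda>y. cmap c (cinv d y)) (at y) (?u y)) has_derivative
    (\<lambda>w. frechet_derivative (\<lambda>y. frechet_derivative (\<lambda>y. cmap c (cinv d y)) (at y) (?u (cmap d x))) (at (cmap d x)) w
       + chart_diff d c x (frechet_derivative ?u (at (cmap d x)) w))) (at (cmap d x))"
    by (rule has_derivative_linear_family[OF T(1) xS _ _ u])
      (use smooth_on_differentiable[OF T(2)] smooth_on_differentiable[OF smooth_on_frechet_derivative[OF T(2)] xS]
        in \<open>auto intro: linear_frechet_derivative\<close>)
  then have "((\<lambda>y. frechet_derivative (\<lambda>y. cmap c (cinv d y)) (at y) (?u y)) has_derivative
    (\<lambda>w. frechet_derivative (\<lambda>y. frechet_derivative (\<lambda>y. cmap c (cinv d y)) (at y) (U x)) (at (cmap d x)) w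
       + dincl A B x (frechet_derivative ?u (at (cmap d x)) w))) (at (cmap d x))"
    unfolding ux by (simp add: dincl_def c_def d_def)
  then show ?thesis
  proof (rule has_derivative_transform_within_open[OF _ T(1) xS])
    fix y assume "y \<in> ?S"
    then obtain z where z: "z \<in> cdom d" "z \<in> cdom c" "y = cmap d z" by auto
    then have "cinv d y = z" using smooth_manifold_chart(1)[OF M(2) d(1)] by simp
    then show "frechet_derivative (\<lambda>y. cmap c (cinv d y)) (at y) (?u y)
        = vec_to A c (cinv d y) (dincl A B (cinv d y) (U (cinv d y)))"
      using vec_to_dincl[OF AB c(1) z(2) d(1) z(1)] z(3) by simp
  qed
qed

text \<open>The second derivatives of the inclusion and the Christoffel terms are symmetric and cancel;
  the bracket in coordinates is what remains.\<close>

lemma cov_along_torsion_free: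
  assumes AB: "submanifold A B" and nab: "levi_civita A g nab" and x: "x \<in> carrier_of B"
    and W: "smooth_vf_on B (carrier_of B) W" and U: "smooth_vf_on B (carrier_of B) U"
  shows "cov_along A B nab (\<lambda>y. dincl A B y (U y)) x (W x)
       - cov_along A B nab (\<lambda>y. dincl A B y (W y)) x (U x) = dincl A B x (lie_bracket B W U x)"
proof -
  define c d where cd: "c = chart_at A x" "d = chart_at B x"
  note M = submanifoldD(1,2)[OF AB]
  have xA: "x \<in> carrier_of A" using x submanifoldD(3)[OF AB] by auto
  have c: "c \<in> A" "x \<in> cdom c" and d: "d \<in> B" "x \<in> cdom d"
    using chart_at x xA by (auto simp: cd)
  note T = submanifold_transition[OF AB c(1) d(1)]
  have sym: "frechet_derivative (\<lambda>y. frechet_derivative (\<lambda>y. cmap c (cinv d y)) (at y) v) (at (cmap d x)) w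
    = frechet_derivative (\<lambda>y. frechet_derivative (\<lambda>y. cmap c (cinv d y)) (at y) w) (at (cmap d x)) v" for v w
    by (rule symmetric_second_derivative[OF T(1) _ T(2)]) (use c d in auto)
  show ?thesis
    unfolding cov_along_def lie_bracket_def Let_def cd[symmetric]
      frechet_derivative_apply[OF dincl_field_has_derivative[OF AB x U cd]]
      frechet_derivative_apply[OF dincl_field_has_derivative[OF AB x W cd]]
      nab_coordinate_fields_commute[OF M(1) nab xA cd(1), of "dincl A B x (U x)"]
      sym[of "U x" "W x"] linear_diff[OF linear_dincl[OF AB x]]
    by simp
qed

lemma metallic_semi_riemannianD:
  assumes "metallic_semi_riemannian p q A g J"
  shows "x \<in> carrier_of A \<Longrightarrow> linear (J x)"
    and "c \<in> A \<Longrightarrow> smooth_on (cmap c ` cdom c)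
      (\<lambda>y. vec_to A c (cinv c y) (J (cinv c y) (vec_from A c (cinv c y) e)))"
    and "x \<in> carrier_of A \<Longrightarrow> J x (J x v) = real p *\<^sub>R J x v + real q *\<^sub>R v"
    and "x \<in> carrier_of A \<Longrightarrow> bilinear (g x)"
    and "x \<in> carrier_of A \<Longrightarrow> g x v w = g x w v"
  using assms unfolding metallic_semi_riemannian_def semi_riemannian_def by simp_all

text \<open>A parallel tensor commutes with the covariant derivative along the submanifold. The field \<open>V\<close>
  need not extend to the ambient manifold, so the hypothesis on \<open>J\<close> is applied to fields
  with constant components only.\<close>

lemma cov_along_parallel:
  fixes A :: "('a, 'e::euclidean_space) chart set" and B :: "('a, 'f::euclidean_space) chart set"
  assumes AB: "submanifold A B" and J: "locally_metallic p q A g nab J" and x: "x \<in> carrier_of B"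
    and cd: "c = chart_at A x" "d = chart_at B x"
    and V: "(\<lambda>y. vec_to A c (cinv d y) (V (cinv d y))) differentiable (at (cmap d x))"
  shows "cov_along A B nab (\<lambda>y. J y (V y)) x w = J x (cov_along A B nab V x w)"
proof -
  note M = submanifoldD(1,2)[OF AB]
  have aff: "affine_connection A nab" and met: "metallic_semi_riemannian p q A g J"
    using J by (simp_all add: locally_metallic_def levi_civita_def)
  have xA: "x \<in> carrier_of A" using x submanifoldD(3)[OF AB] by auto
  have c: "c \<in> A" "x \<in> cdom c" and d: "d \<in> B" "x \<in> cdom d"
    using chart_at x xA by (auto simp: cd)
  have linJ: "linear (J z)" if "z \<in> cdom c" for z
    by (rule metallic_semi_riemannianD(1)[OF met cdom_carrier[OF c(1) that]])
  \<comment> \<open>The matrix of \<open>J\<close> in the chart \<open>c\<close>, applied to the vector \<open>e\<close> of components.\<close>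
  define m where "m e z = vec_to A c z (J z (vec_from A c z e))" for e z
  have m_lin: "linear (\<lambda>e. m e z)" if "z \<in> cdom c" for z
    unfolding m_def
    using linear_compose[OF linear_compose[OF linear_vec_from[OF M(1) c(1) that] linJ[OF that]]
        linear_vec_to[OF M(1) c(1) that]] by (simp add: o_def)
  have m_smooth: "smooth_on (cmap c ` cdom c) (\<lambda>y. m e (cinv c y))" for e
    unfolding m_def by (rule metallic_semi_riemannianD(2)[OF met c(1)])
  have mx: "m e x = J x e" for e
    by (simp add: m_def cd(1) vec_to_chart_at[OF M(1) xA] vec_from_chart_at[OF M(1) xA])
  let ?S = "cmap d ` (cdom d \<inter> cdom c)" and ?v = "\<lambda>y. vec_to A c (cinv d y) (V (cinv d y))"
  let ?Dv = "frechet_derivative ?v (at (cmap d x))"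
  let ?Dm = "\<lambda>e. frechet_derivative (\<lambda>y. m e (cinv c y)) (at (cmap c x))"
  let ?E = "\<lambda>e y. vec_from A c y e"
  note T = submanifold_transition[OF AB c(1) d(1)]
  note inj = smooth_manifold_chart(1)[OF M(1) c(1)] smooth_manifold_chart(1)[OF M(2) d(1)]
  have xS: "cmap d x \<in> ?S" and inv: "cinv d (cmap d x) = x" using c d inj by auto
  have vx: "vec_to A c x (V x) = V x" by (simp add: cd(1) vec_to_chart_at[OF M(1) xA])
  have Dm: "((\<lambda>y. m e (cinv d y)) has_derivative (\<lambda>v. ?Dm e (dincl A B x v))) (at (cmap d x))" for e
    unfolding dincl_def cd(1,2)[symmetric]
    by (rule has_derivative_change_of_chart)
      (use inj T c d smooth_on_differentiable[OF m_smooth] in auto)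
  have "((\<lambda>y. m (?v y) (cinv d y)) has_derivative
      (\<lambda>w. frechet_derivative (\<lambda>y. m (?v (cmap d x)) (cinv d y)) (at (cmap d x)) w
        + m (?Dv w) (cinv d (cmap d x)))) (at (cmap d x))"
    by (rule has_derivative_linear_family[OF T(1) xS, where \<Phi> = "\<lambda>y e. m e (cinv d y)"])
      (use V m_lin inj Dm in \<open>auto simp: differentiable_def\<close>)
  then have "((\<lambda>y. m (?v y) (cinv d y)) has_derivative (\<lambda>w. ?Dm (V x) (dincl A B x w) + J x (?Dv w)))
      (at (cmap d x))"
    unfolding inv vx mx frechet_derivative_apply[OF Dm] .
  then have "((\<lambda>y. vec_to A c (cinv d y) (J (cinv d y) (V (cinv d y)))) has_derivative
      (\<lambda>w. ?Dm (V x) (dincl A B x w) + J x (?Dv w))) (at (cmap d x))"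
    by (rule has_derivative_transform_within_open[OF _ T(1) xS])
      (use inj in \<open>auto simp: m_def vec_from_vec_to[OF M(1) c(1)]\<close>)
  note D = frechet_derivative_apply[OF this]
  have "J x (nab (?E e) x u) = nab (\<lambda>y. J y (?E e y)) x u" for e u
    using J[unfolded locally_metallic_def, THEN conjunct2, THEN conjunct2, THEN spec, THEN spec,
        THEN mp, OF conjI[OF openin_cdom[OF c(1)] smooth_vf_on_chart[OF M(1) c(1) smooth_on_const]],
        THEN bspec, OF c(2), THEN spec, of e u] by simp
  also have "nab (\<lambda>y. J y (?E e y)) x u = nab (\<lambda>y. vec_from A c y (m e y)) x u" for e u
    by (rule affine_connection_local[OF aff openin_cdom[OF c(1)] smooth_vf_on_chart[OF M(1) c(1) m_smooth] c(2)])
      (simp add: m_def vec_from_vec_to[OF M(1) c(1)])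
  also have "nab (\<lambda>y. vec_from A c y (m e y)) x u = ?Dm e u + nab (?E (J x e)) x u" for e u
    unfolding nab_chart[OF M(1) aff xA cd(1) m_smooth] mx ..
  finally have "J x (nab (?E (V x)) x (dincl A B x w))
      = ?Dm (V x) (dincl A B x w) + nab (?E (J x (V x))) x (dincl A B x w)" .
  then show ?thesis
    unfolding cov_along_def Let_def cd[symmetric] D linear_add[OF linJ[OF c(2)]] by simp
qed

section \<open>Linear algebra of a lightlike subspace\<close>

text \<open>A form that is non-degenerate on \<open>V\<close> represents the restriction to \<open>V\<close> of every linear form.\<close>

lemma nondegenerate_on_represents:
  fixes V :: "'v::euclidean_space set"
  assumes V: "subspace V" and b: "bilinear b" and nd: "nondegenerate_on V b" and f: "linear f"
  obtains v where "v \<in> V" "\<And>w. w \<in> V \<Longrightarrow> b v w = (f w :: real)"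
proof -
  obtain E where E: "E \<subseteq> V" "pairwise orthogonal E" "\<And>x. x \<in> E \<Longrightarrow> norm x = 1"
    "independent E" "card E = dim V" "span E = V"
    using orthonormal_basis_subspace[OF V] by metis
  have "finite E" using E(4) independent_imp_finite by blast
  \<comment> \<open>The vector of \<open>V\<close> that represents a linear form with respect to the Euclidean product.\<close>
  define \<rho> where "\<rho> h = (\<Sum>e\<in>E. h e *\<^sub>R e)" for h :: "'v \<Rightarrow> real"
  have \<rho>V: "\<rho> h \<in> V" for h
    unfolding \<rho>_def using E V by (intro subspace_sum subspace_scale) auto
  have rep: "h w = \<rho> h \<bullet> w" if "linear h" "w \<in> V" for h :: "'v \<Rightarrow> real" and w
  proof (rule linear_eq_on_span[of h "\<lambda>w. \<rho> h \<bullet> w" E])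
    show "linear (\<lambda>w. \<rho> h \<bullet> w)" by (intro bounded_linear.linear bounded_linear_inner_right)
    fix e assume e: "e \<in> E"
    have "\<rho> h \<bullet> e = (\<Sum>e'\<in>E. if e' = e then h e else 0)"
      unfolding \<rho>_def inner_sum_left
    proof (rule sum.cong)
      fix e' assume e': "e' \<in> E"
      show "h e' *\<^sub>R e' \<bullet> e = (if e' = e then h e else 0)"
        using E(2,3) e e' by (auto simp: pairwise_def orthogonal_def norm_eq_1)
    qed simp
    also have "\<dots> = h e" using \<open>finite E\<close> e by simp
    finally show "h e = \<rho> h \<bullet> e" ..
  qed (use that E(6) in auto)
  have bl: "linear (\<lambda>v. b v w)" "linear (b v)" for v w
    using b by (auto simp: bilinear_def)
  define M where "M v = \<rho> (b v)" for v
  have linM: "linear M"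
    unfolding M_def \<rho>_def using bl(1)
    by (intro linear_compose_sum ballI) (auto simp: linear_iff scaleR_add_left)
  have "inj_on M V"
  proof (rule inj_onI)
    fix v v' assume v: "v \<in> V" "v' \<in> V" "M v = M v'"
    then have "b v w = b v' w" if "w \<in> V" for w
      using rep[OF bl(2) that] by (simp add: M_def)
    then have "\<forall>w\<in>V. b (v - v') w = 0"
      using linear_diff[OF bl(1)] by simp
    moreover have "v - v' \<in> V" using subspace_diff[OF V] v by simp
    ultimately have "v - v' = 0" using nd unfolding nondegenerate_on_def by blast
    then show "v = v'" by simp
  qed
  moreover have "span V = V" using V by (simp add: span_eq_iff)
  ultimately have "inj_on M (span V)" by (simp only:)
  then have "dim (M ` V) = dim V" by (rule dim_image_eq[OF linM])
  moreover have "M ` V \<subseteq> V" using \<rho>V by (auto simp: M_def)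
  ultimately have "M ` V = V"
    using subspace_dim_equal[of "M ` V" V] V linM linear_subspace_image by auto
  then have "\<rho> f \<in> M ` V" using \<rho>V by simp
  then obtain v where v: "v \<in> V" "M v = \<rho> f" by (metis imageE)
  show thesis
  proof
    show "b v w = f w" if "w \<in> V" for w
      using rep[OF bl(2) that, of v] rep[OF f that] v(2) by (simp add: M_def)
  qed (rule v(1))
qed

text \<open>The situation at one point of a lightlike submanifold: \<open>T\<close> is the differential of the
  inclusion, \<open>G\<close> the ambient scalar product, and \<open>S\<close>, \<open>P\<close>, \<open>L\<close> are the fibres of the screen
  distribution, of the screen transversal bundle and of the lightlike transversal bundle. The
  radical \<open>R\<close> and the normal space are determined by \<open>T\<close> and \<open>G\<close>.\<close>

locale lightlike_splitting =
  fixes T :: "'f::euclidean_space \<Rightarrow> 'e::euclidean_space"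
    and G :: "'e \<Rightarrow> 'e \<Rightarrow> real"
    and R S :: "'f set" and P L :: "'e set"
  assumes T: "linear T" "inj T"
    and G: "bilinear G" "\<And>v w. G v w = G w v"
    and R_def: "R = {w. \<forall>u. G (T w) (T u) = 0}"
    and S: "direct_sum_of UNIV R S" "nondegenerate_on (T ` S) G"
    and P: "direct_sum_of {v. \<forall>w. G v (T w) = 0} (T ` R) P"
    and L: "\<exists>(k::nat) \<xi> N. span (\<xi> ` {..<k}) = R \<and> span (N ` {..<k}) = L \<and>
      (\<forall>i<k. \<forall>j<k. G (T (\<xi> i)) (N j) = (if i = j then 1 else (0::real)))"
begin

lemma linear_G: "linear (G v)" "linear (\<lambda>v. G v w)"
  using G(1) by (auto simp: bilinear_def)

lemma subspace_R: "subspace R" and subspace_S: "subspace S" and subspace_P: "subspace P"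
  and R_S: "R \<inter> S = {0}" and R_P: "T ` R \<inter> P = {0}"
  using S(1) P by (auto simp: direct_sum_of_def)

lemma P_normal: "s \<in> P \<Longrightarrow> G s (T w) = 0"
proof -
  assume "s \<in> P"
  moreover have "0 \<in> T ` R" using P subspace_0 by (auto simp: direct_sum_of_def)
  ultimately have "0 + s \<in> {v. \<forall>w. G v (T w) = 0}" using P unfolding direct_sum_of_def by blast
  then show ?thesis by simp
qed

lemma L_frame:
  obtains k :: nat and \<xi> N where "span (\<xi> ` {..<k}) = R" "span (N ` {..<k}) = L"
    "\<And>i j. i < k \<Longrightarrow> j < k \<Longrightarrow> G (T (\<xi> i)) (N j) = (if i = j then 1 else 0)"
  using L by metis

lemma subspace_L: "subspace L"
  by (rule L_frame) (metis subspace_span)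

text \<open>The pairing of the radical with the lightlike transversal space is perfect.\<close>

lemma L_eq_0:
  assumes l: "l \<in> L" and 0: "\<And>r. r \<in> R \<Longrightarrow> G (T r) l = 0"
  shows "l = 0"
proof -
  obtain k :: nat and \<xi> N where f: "span (\<xi> ` {..<k}) = R" "span (N ` {..<k}) = L"
    "\<And>i j. i < k \<Longrightarrow> j < k \<Longrightarrow> G (T (\<xi> i)) (N j) = (if i = j then 1 else 0)"
    by (rule L_frame) (rule that)
  have "l = (\<Sum>i<k. G (T (\<xi> i)) l *\<^sub>R N i)"
  proof (rule linear_eq_on_span[of "\<lambda>l. l" "\<lambda>l. \<Sum>i<k. G (T (\<xi> i)) l *\<^sub>R N i" "N ` {..<k}"])
    show "linear (\<lambda>l. \<Sum>i<k. G (T (\<xi> i)) l *\<^sub>R N i)"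
      using linear_G(1) by (intro linear_compose_sum ballI) (auto simp: linear_iff scaleR_add_left)
    fix n assume "n \<in> N ` {..<k}"
    then obtain j where j: "j < k" "n = N j" by auto
    have "(\<Sum>i<k. G (T (\<xi> i)) n *\<^sub>R N i) = (\<Sum>i<k. if i = j then n else 0)"
      by (rule sum.cong) (use j f(3) in auto)
    then show "n = (\<Sum>i<k. G (T (\<xi> i)) n *\<^sub>R N i)" using j by simp
  qed (use l f(2) linear_id in \<open>auto simp: id_def\<close>)
  also have "\<dots> = 0"
  proof (rule sum.neutral, rule ballI)
    fix i assume "i \<in> {..<k}"
    then have "\<xi> i \<in> R" unfolding f(1)[symmetric] by (intro span_base imageI)
    then show "G (T (\<xi> i)) l *\<^sub>R N i = 0" using 0 by simp
  qed
  finally show ?thesis .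
qed

lemma L_represents:
  obtains l where "l \<in> L" "\<And>r. r \<in> R \<Longrightarrow> G (T r) l = G (T r) v"
proof -
  obtain k :: nat and \<xi> N where f: "span (\<xi> ` {..<k}) = R" "span (N ` {..<k}) = L"
    "\<And>i j. i < k \<Longrightarrow> j < k \<Longrightarrow> G (T (\<xi> i)) (N j) = (if i = j then 1 else 0)"
    by (rule L_frame) (rule that)
  define l where "l = (\<Sum>i<k. G (T (\<xi> i)) v *\<^sub>R N i)"
  show thesis
  proof
    show "l \<in> L"
      unfolding l_def f(2)[symmetric] by (intro span_sum span_scale span_base) auto
    show "G (T r) l = G (T r) v" if "r \<in> R" for r
    proof (rule linear_eq_on_span[of "\<lambda>r. G (T r) l" "\<lambda>r. G (T r) v" "\<xi> ` {..<k}"])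
      show "linear (\<lambda>r. G (T r) l)" "linear (\<lambda>r. G (T r) v)"
        using linear_compose[OF T(1) linear_G(2)] by (auto simp: o_def)
      fix e assume "e \<in> \<xi> ` {..<k}"
      then obtain j where j: "j < k" "e = \<xi> j" by auto
      have "G (T e) l = (\<Sum>i<k. G (T (\<xi> i)) v * G (T e) (N i))"
        unfolding l_def by (simp add: linear_sum[OF linear_G(1)] linear_cmul[OF linear_G(1)])
      also have "\<dots> = (\<Sum>i<k. if i = j then G (T e) v else 0)"
        by (rule sum.cong) (use j f(3) in auto)
      finally show "G (T e) l = G (T e) v" using j by simp
    qed (use that f(1) in auto)
  qed
qed

text \<open>The ambient space is the direct sum of \<open>range T\<close>, \<open>L\<close> and \<open>P\<close>. A vector \<open>v\<close> is corrected by an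
  element of \<open>L\<close> to become orthogonal to the radical and then by one of \<open>T ` S\<close> to
  become normal; the normal space is the sum of \<open>T ` R\<close> and \<open>P\<close>.\<close>

lemma splitting_exists: "\<exists>t. \<exists>l\<in>L. \<exists>s\<in>P. v = T t + l + s"
proof -
  obtain l where l: "l \<in> L" "\<And>r. r \<in> R \<Longrightarrow> G (T r) l = G (T r) v"
    by (rule L_represents) (rule that)
  have "subspace (T ` S)" using linear_subspace_image[OF T(1) subspace_S] .
  from nondegenerate_on_represents[OF this G(1) S(2) linear_G(1)[of "v - l"]]
  obtain z where z: "z \<in> T ` S" "\<And>w. w \<in> T ` S \<Longrightarrow> G z w = G (v - l) w" by metis
  then obtain s where s: "s \<in> S" "z = T s" by blast
  then have Gs: "G (T s) (T u) = G (v - l) (T u)" if "u \<in> S" for u using z(2) that by simp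
  have "G (v - l - T s) (T w) = 0" for w
  proof -
    obtain r u where w: "w = r + u" "r \<in> R" "u \<in> S" using S(1) unfolding direct_sum_of_def by blast
    have "G (v - l - T s) (T r) = G (T r) v - G (T r) l - G (T r) (T s)"
      by (simp add: G(2)[of _ "T r"] linear_diff[OF linear_G(1)])
    moreover have "G (T r) (T s) = 0" using w(2) R_def by blast
    ultimately have "G (v - l - T s) (T r) = 0" using l(2)[OF w(2)] by simp
    moreover have "G (v - l - T s) (T u) = 0"
      using Gs[OF w(3)] by (simp add: linear_diff[OF linear_G(2)])
    ultimately show ?thesis by (simp add: w(1) linear_add[OF T(1)] linear_add[OF linear_G(1)])
  qed
  then obtain r z where rz: "v - l - T s = T r + z" "r \<in> R" "z \<in> P"
    using P unfolding direct_sum_of_def by blast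
  have "v = T (s + r) + l + z" using rz(1) by (simp add: linear_add[OF T(1)] algebra_simps)
  with l(1) rz(3) show ?thesis by blast
qed

text \<open>Pairing the relation with the radical kills all terms but the one in \<open>L\<close>, which therefore
  vanishes.\<close>

lemma splitting_unique:
  assumes "T t + l + s = 0" "l \<in> L" "s \<in> P"
  shows "t = 0"
proof -
  have "l = 0"
  proof (rule L_eq_0[OF assms(2)])
    fix r assume r: "r \<in> R"
    have "G (T r) (T t + l + s) = 0" unfolding assms(1) by (rule linear_0[OF linear_G(1)])
    moreover have "G (T r) (T t) = 0" using r R_def by blast
    moreover have "G (T r) s = 0" using P_normal[OF assms(3)] G(2) by simp
    ultimately show "G (T r) l = 0" by (simp add: linear_add[OF linear_G(1)])
  qed
  then have Tt: "T t = - s" using assms(1) by (simp add: eq_neg_iff_add_eq_0)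
  have "G (T t) (T u) = 0" for u
    unfolding Tt using P_normal[OF assms(3)] by (simp add: linear_neg[OF linear_G(2)])
  then have "t \<in> R" by (simp add: R_def)
  then have "T t \<in> T ` R" by (rule imageI)
  moreover have "T t \<in> P" unfolding Tt by (rule subspace_neg[OF subspace_P assms(3)])
  ultimately have "T t \<in> T ` R \<inter> P" by simp
  then have "T t = 0" using R_P by blast
  then show ?thesis using T linear_injective_0 by blast
qed

text \<open>The component of an ambient vector in \<open>range T\<close> along \<open>L\<close> and \<open>P\<close>, as a vector of the
  domain of \<open>T\<close>.\<close>

definition tpart :: "'e \<Rightarrow> 'f" where
  "tpart v = (THE t. \<exists>l\<in>L. \<exists>s\<in>P. v = T t + l + s)"

lemma tpart_eqI:
  assumes "v = T t + l + s" "l \<in> L" "s \<in> P"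
  shows "tpart v = t"
  unfolding tpart_def
proof (rule the_equality)
  show "\<exists>l\<in>L. \<exists>s\<in>P. v = T t + l + s" using assms by blast
  fix t' assume "\<exists>l\<in>L. \<exists>s\<in>P. v = T t' + l + s"
  then obtain l' s' where *: "l' \<in> L" "s' \<in> P" "v = T t' + l' + s'" by blast
  have "T t' + l' + s' = T t + l + s" using *(3) assms(1) by simp
  then have "T (t' - t) + (l' - l) + (s' - s) = 0"
    by (simp add: linear_diff[OF T(1)] algebra_simps)
  then have "t' - t = 0"
    using splitting_unique[of "t' - t" "l' - l" "s' - s"] subspace_diff[OF subspace_L, of l' l]
      subspace_diff[OF subspace_P, of s' s] assms(2,3) * by simp
  then show "t' = t" by simp
qed

lemma tpart_diff: "tpart (v - w) = tpart v - tpart w"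
proof -
  obtain t l s where v: "v = T t + l + s" "l \<in> L" "s \<in> P" using splitting_exists[of v] by blast
  obtain t' l' s' where w: "w = T t' + l' + s'" "l' \<in> L" "s' \<in> P"
    using splitting_exists[of w] by blast
  have "tpart (v - w) = t - t'"
    by (rule tpart_eqI[of _ _ "l - l'" "s - s'"])
      (use v w subspace_diff[OF subspace_L] subspace_diff[OF subspace_P] in
        \<open>simp_all add: linear_diff[OF T(1)]\<close>)
  then show ?thesis using tpart_eqI[OF v] tpart_eqI[OF w] by simp
qed

lemma tpart_T: "tpart (T t) = t"
  by (rule tpart_eqI[of _ _ 0 0]) (use subspace_0 subspace_L subspace_P in auto)

lemma tpart_P: "s \<in> P \<Longrightarrow> tpart s = 0"
  by (rule tpart_eqI[of _ _ 0 s]) (use subspace_0 subspace_L linear_0[OF T(1)] in auto)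

text \<open>The component in \<open>S\<close> along the radical.\<close>

definition spart :: "'f \<Rightarrow> 'f" where
  "spart v = (THE s. s \<in> S \<and> (\<exists>t\<in>R. v = s + t))"

lemma spart_eqI:
  assumes "v = s + t" "s \<in> S" "t \<in> R"
  shows "spart v = s"
  unfolding spart_def
proof (rule the_equality)
  show "s \<in> S \<and> (\<exists>t\<in>R. v = s + t)" using assms by blast
  fix s' assume "s' \<in> S \<and> (\<exists>t\<in>R. v = s' + t)"
  then obtain t' where *: "s' \<in> S" "t' \<in> R" "v = s' + t'" by blast
  then have "s' - s = t - t'" using assms(1) by (simp add: algebra_simps)
  moreover have "s' - s \<in> S" "t - t' \<in> R"
    using * assms(2,3) subspace_diff[OF subspace_S] subspace_diff[OF subspace_R] by simp_all
  ultimately have "s' - s \<in> R \<inter> S" by simp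
  then have "s' - s = 0" using R_S by simp
  then show "s' = s" by simp
qed

lemma spart_exists:
  obtains t where "v = spart v + t" "spart v \<in> S" "t \<in> R"
proof -
  obtain r s where "v = r + s" "r \<in> R" "s \<in> S" using S(1) unfolding direct_sum_of_def by blast
  moreover from this have "spart v = s" using spart_eqI[of v s r] by (simp add: add.commute)
  ultimately show thesis using that[of r] by (simp add: add.commute)
qed

lemma spart_diff: "spart (v - w) = spart v - spart w"
proof -
  obtain t where t: "v = spart v + t" "spart v \<in> S" "t \<in> R" using spart_exists .
  obtain t' where t': "w = spart w + t'" "spart w \<in> S" "t' \<in> R" using spart_exists .
  have "v - w = (spart v + t) - (spart w + t')" using t(1) t'(1) by simp
  then have "v - w = (spart v - spart w) + (t - t')" by simp
  then show ?thesis
    by (rule spart_eqI) (use t t' subspace_diff[OF subspace_S] subspace_diff[OF subspace_R] in simp_all)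
qed

lemma spart_eq_0_iff: "spart v = 0 \<longleftrightarrow> v \<in> R"
proof
  obtain t where "v = spart v + t" "t \<in> R" using spart_exists .
  moreover assume "spart v = 0"
  ultimately show "v \<in> R" by simp
next
  assume "v \<in> R"
  then show "spart v = 0" using spart_eqI[of v 0 v] subspace_0[OF subspace_S] by simp
qed

text \<open>Only the screen component of \<open>b\<close> contributes to the tangential part of \<open>J (T b)\<close>.\<close>

lemma tpart_J_eq:
  assumes J: "linear J" and R: "J ` T ` R \<subseteq> P" and S: "J ` T ` S = T ` S"
  shows "T (tpart (J (T b))) = J (T (spart b))" "tpart (J (T b)) \<in> S"
proof -
  obtain t where t: "b = spart b + t" "spart b \<in> S" "t \<in> R" using spart_exists .
  obtain s where s: "s \<in> S" "J (T (spart b)) = T s" using S t(2) by blast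
  have "J (T b) = T s + 0 + J (T t)"
    using t(1) s(2) linear_add[OF J] linear_add[OF T(1)] by (metis add.right_neutral)
  then have "tpart (J (T b)) = s"
    by (rule tpart_eqI) (use R t(3) subspace_0[OF subspace_L] in auto)
  with s show "T (tpart (J (T b))) = J (T (spart b))" "tpart (J (T b)) \<in> S" by auto
qed

text \<open>The eigenvalue \<open>p\<close> is excluded for \<open>J\<close>, since it is not a root of \<open>X\<^sup>2 - p X - q\<close> when
  \<open>q \<noteq> 0\<close>.\<close>

lemma in_radical_if_tpart_J_eq:
  assumes J: "linear J" "J ` T ` R \<subseteq> P" "J ` T ` S = T ` S"
    and J2: "\<And>v. J (J v) = p *\<^sub>R J v + q *\<^sub>R v" and "q \<noteq> 0"
    and b: "tpart (J (T b)) = p *\<^sub>R spart b"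
  shows "b \<in> R"
proof -
  let ?v = "T (spart b)"
  have "J ?v = p *\<^sub>R ?v" using tpart_J_eq(1)[OF J, of b] by (simp add: b linear_cmul[OF T(1)])
  then have "q *\<^sub>R ?v = 0" using J2[of ?v] by (simp add: linear_cmul[OF J(1)])
  then have "?v = 0" using \<open>q \<noteq> 0\<close> by simp
  then have "spart b = 0" using T linear_injective_0 by blast
  then show ?thesis by (simp add: spart_eq_0_iff)
qed

lemma tpart_J_in_radical:
  assumes "linear J" "J ` T ` R \<subseteq> P" "J ` T ` S = T ` S" and "b \<in> R"
  shows "tpart (J (T b)) \<in> R"
proof -
  have "tpart (J (T b)) = 0" using assms by (intro tpart_P) auto
  then show ?thesis using subspace_0[OF subspace_R] by simp
qed

end

section \<open>Integrability of the radical distribution\<close>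

lemma lightlike_splitting_at:
  fixes A :: "('a, 'e::euclidean_space) chart set" and B :: "('a, 'f::euclidean_space) chart set"
  assumes metal: "metallic_semi_riemannian p q A g J"
    and ll: "lightlike_submanifold A g B r"
    and S: "screen_distribution A g B S"
    and Sperp: "screen_transversal_bundle A g B Sperp"
    and ltr: "lightlike_transversal_bundle A g B S Sperp ltr"
    and x: "x \<in> carrier_of B"
  shows "lightlike_splitting (dincl A B x) (g x) (Rad A g B x) (S x) (Sperp x) (ltr x)"
proof (rule lightlike_splitting.intro)
  have AB: "submanifold A B" using ll by (simp add: lightlike_submanifold_def)
  then have xA: "x \<in> carrier_of A" using submanifoldD(3) x by blast
  show "linear (dincl A B x)" "inj (dincl A B x)"
    using linear_dincl[OF AB x] submanifoldD(4)[OF AB x] by auto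
  show "bilinear (g x)" by (rule metallic_semi_riemannianD(4)[OF metal xA])
  show "g x v w = g x w v" for v w by (rule metallic_semi_riemannianD(5)[OF metal xA])
  show "Rad A g B x = {w. \<forall>u. g x (dincl A B x w) (dincl A B x u) = 0}"
    by (simp add: Rad_def normal_space_def)
  show "direct_sum_of UNIV (Rad A g B x) (S x)" "nondegenerate_on (dincl A B x ` S x) (g x)"
    using S x by (auto simp: screen_distribution_def)
  show "direct_sum_of {v. \<forall>w. g x v (dincl A B x w) = 0} (dincl A B x ` Rad A g B x) (Sperp x)"
    using Sperp x by (auto simp: screen_transversal_bundle_def normal_space_def)
  have "smooth_subbundle B (smooth_vf_on B) (Rad A g B)"
    using ll by (simp add: lightlike_submanifold_def)
  then obtain U k \<xi> where U: "openin (mtop B) U" "x \<in> U"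
    and \<xi>: "local_frame (smooth_vf_on B) U k \<xi> (Rad A g B)"
    using x unfolding smooth_subbundle_def by meson
  obtain U' N where N: "x \<in> U'" "local_frame (smooth_along_on A B) U' k N ltr"
    "\<forall>y\<in>U'. \<forall>i<k. \<forall>j<k. g y (dincl A B y (\<xi> i y)) (N j y) = (if i = j then 1 else 0) \<and>
      g y (N i y) (N j y) = 0"
    using ltr[unfolded lightlike_transversal_bundle_def, THEN conjunct2, THEN conjunct2, THEN spec,
        THEN spec, THEN spec, THEN mp, OF conjI[OF U(1) \<xi>], THEN bspec, OF U(2)] by blast
  have "span ((\<lambda>i. \<xi> i x) ` {..<k}) = Rad A g B x" "span ((\<lambda>i. N i x) ` {..<k}) = ltr x"
    using \<xi> U(2) N(1,2) by (simp_all add: local_frame_def)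
  moreover have "\<forall>i<k. \<forall>j<k. g x (dincl A B x (\<xi> i x)) (N j x) = (if i = j then 1 else 0)"
    using N(3) N(1) by simp
  ultimately have frame: "span ((\<lambda>i. \<xi> i x) ` {..<k}) = Rad A g B x \<and> span ((\<lambda>i. N i x) ` {..<k}) = ltr x \<and>
      (\<forall>i<k. \<forall>j<k. g x (dincl A B x (\<xi> i x)) (N j x) = (if i = j then 1 else (0::real)))"
    by simp
  show "\<exists>(k::nat) \<xi> N. span (\<xi> ` {..<k}) = Rad A g B x \<and> span (N ` {..<k}) = ltr x \<and>
      (\<forall>i<k. \<forall>j<k. g x (dincl A B x (\<xi> i)) (N j) = (if i = j then 1 else (0::real)))"
    using frame by (intro exI)
qed

text \<open>The antisymmetrized shape operators are functions of the bracket alone. This holds for all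
  tangent fields, not only for those in the radical distribution.\<close>

lemma shape_operators_difference:
  fixes A :: "('a, 'e::euclidean_space) chart set" and B :: "('a, 'f::euclidean_space) chart set"
  assumes J: "locally_metallic p q A g nab J" and AB: "submanifold A B" and x: "x \<in> carrier_of B"
    and split: "lightlike_splitting (dincl A B x) (g x) (Rad A g B x) (S x) (Sperp x) (ltr x)"
    and W: "smooth_vf_on B (carrier_of B) W" and U: "smooth_vf_on B (carrier_of B) U"
  shows "shape_op A B nab Sperp ltr (J_along A B J W) U x - shape_op A B nab Sperp ltr (J_along A B J U) W x
      = lightlike_splitting.tpart (dincl A B x) (Sperp x) (ltr x) (J x (dincl A B x (lie_bracket B W U x)))"
    and "screen_shape_op A g B nab S Sperp ltr W U x - screen_shape_op A g B nab S Sperp ltr U W x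
      = lightlike_splitting.spart (Rad A g B x) (S x) (lie_bracket B W U x)"
proof -
  interpret lightlike_splitting "dincl A B x" "g x" "Rad A g B x" "S x" "Sperp x" "ltr x"
    by (rule split)
  have met: "metallic_semi_riemannian p q A g J" and lc: "levi_civita A g nab"
    using J by (simp_all add: locally_metallic_def)
  have linJ: "linear (J x)"
    using metallic_semi_riemannianD(1)[OF met] submanifoldD(3)[OF AB] x by blast
  let ?C = "\<lambda>X v. cov_along A B nab (\<lambda>y. dincl A B y (X y)) x v"
  have tp: "tangent_part A B Sperp ltr x = tpart"
    by (rule ext) (simp add: tangent_part_def tpart_def)
  have par: "cov_along A B nab (J_along A B J X) x v = J x (?C X v)"
    if "smooth_vf_on B (carrier_of B) X" for X v
    unfolding J_along_def
    by (rule cov_along_parallel[OF AB J x refl refl])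
      (use dincl_field_has_derivative[OF AB x that refl refl] in \<open>auto simp: differentiable_def\<close>)
  note tors = cov_along_torsion_free[OF AB lc x W U]
  have "shape_op A B nab Sperp ltr (J_along A B J W) U x - shape_op A B nab Sperp ltr (J_along A B J U) W x
      = tpart (J x (?C U (W x)) - J x (?C W (U x)))"
    by (simp add: shape_op_def tp par[OF W] par[OF U] tpart_diff)
  also have "J x (?C U (W x)) - J x (?C W (U x)) = J x (dincl A B x (lie_bracket B W U x))"
    unfolding tors[symmetric] by (simp add: linear_diff[OF linJ])
  finally show "shape_op A B nab Sperp ltr (J_along A B J W) U x
      - shape_op A B nab Sperp ltr (J_along A B J U) W x = tpart (J x (dincl A B x (lie_bracket B W U x)))" .
  have "screen_shape_op A g B nab S Sperp ltr W U x - screen_shape_op A g B nab S Sperp ltr U W x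
      = spart (tpart (?C U (W x) - ?C W (U x)))"
    by (simp add: screen_shape_op_def induced_conn_def tp tpart_diff spart_diff
        flip: spart_def)
  also have "\<dots> = spart (lie_bracket B W U x)"
    unfolding tors tpart_T ..
  finally show "screen_shape_op A g B nab S Sperp ltr W U x - screen_shape_op A g B nab S Sperp ltr U W x
      = spart (lie_bracket B W U x)" .
qed

theorem theorem3p14:
  fixes p q r :: nat
    and A :: "('a, 'e::euclidean_space) chart set"
    and g :: "'a \<Rightarrow> 'e \<Rightarrow> 'e \<Rightarrow> real"
    and nab :: "('a \<Rightarrow> 'e) \<Rightarrow> 'a \<Rightarrow> 'e \<Rightarrow> 'e"
    and J :: "'a \<Rightarrow> 'e \<Rightarrow> 'e"
    and B :: "('a, 'f::euclidean_space) chart set"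
    and S :: "'a \<Rightarrow> 'f set"
    and Sperp ltr :: "'a \<Rightarrow> 'e set"
  assumes "0 < p" and "0 < q"
    and "locally_metallic p q A g nab J"
    and "lightlike_submanifold A g B r"
    and "screen_distribution A g B S"
    and "screen_transversal_bundle A g B Sperp"
    and "lightlike_transversal_bundle A g B S Sperp ltr"
    and "radical_screen_transversal A g J B S Sperp"
  shows "integrable_distribution B (Rad A g B) \<longleftrightarrow>
    (\<forall>W\<in>tangent_sections B (Rad A g B). \<forall>U\<in>tangent_sections B (Rad A g B). \<forall>x\<in>carrier_of B.
       shape_op A B nab Sperp ltr (J_along A B J W) U x - shape_op A B nab Sperp ltr (J_along A B J U) W x =
       real p *\<^sub>R (screen_shape_op A g B nab S Sperp ltr W U x - screen_shape_op A g B nab S Sperp ltr U W x))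
    \<or>
    (\<forall>W\<in>tangent_sections B (Rad A g B). \<forall>U\<in>tangent_sections B (Rad A g B). \<forall>x\<in>carrier_of B.
       screen_shape_op A g B nab S Sperp ltr W U x = screen_shape_op A g B nab S Sperp ltr U W x \<and>
       shape_op A B nab Sperp ltr (J_along A B J W) U x - shape_op A B nab Sperp ltr (J_along A B J U) W x
         \<in> Rad A g B x)"
proof -
  let ?\<Gamma> = "tangent_sections B (Rad A g B)"
  have met: "metallic_semi_riemannian p q A g J" and AB: "submanifold A B"
    using assms(3,4) by (simp_all add: locally_metallic_def lightlike_submanifold_def)
  note split = lightlike_splitting_at[OF met assms(4-7)]
  let ?t = "\<lambda>x. lightlike_splitting.tpart (dincl A B x) (Sperp x) (ltr x)"
  let ?s = "\<lambda>x. lightlike_splitting.spart (Rad A g B x) (S x)"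
  let ?JT = "\<lambda>x b. J x (dincl A B x b)"
  have sm: "smooth_vf_on B (carrier_of B) W" if "W \<in> ?\<Gamma>" for W
    using that by (simp add: tangent_sections_def)
  have diffs: "shape_op A B nab Sperp ltr (J_along A B J W) U x
      - shape_op A B nab Sperp ltr (J_along A B J U) W x = ?t x (?JT x (lie_bracket B W U x))"
    "screen_shape_op A g B nab S Sperp ltr W U x - screen_shape_op A g B nab S Sperp ltr U W x
      = ?s x (lie_bracket B W U x)"
    if "W \<in> ?\<Gamma>" "U \<in> ?\<Gamma>" "x \<in> carrier_of B" for W U x
    using shape_operators_difference[where S = S and Sperp = Sperp and ltr = ltr,
        OF assms(3) AB that(3) split[OF that(3)] sm[OF that(1)] sm[OF that(2)]]
    by auto
  have Jx: "linear (J x)" "\<And>v. J x (J x v) = real p *\<^sub>R J x v + real q *\<^sub>R v"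
    "J x ` dincl A B x ` Rad A g B x \<subseteq> Sperp x" "J x ` dincl A B x ` S x = dincl A B x ` S x"
    if "x \<in> carrier_of B" for x
    using metallic_semi_riemannianD(1,3)[OF met] submanifoldD(3)[OF AB] assms(8) that
    by (auto simp: radical_screen_transversal_def)
  have rad: "?s x b = 0 \<longleftrightarrow> b \<in> Rad A g B x" if "x \<in> carrier_of B" for x b
    by (rule lightlike_splitting.spart_eq_0_iff[OF split[OF that]])
  have b: "?s x b = 0 \<and> ?t x (?JT x b) \<in> Rad A g B x \<longleftrightarrow> b \<in> Rad A g B x" if "x \<in> carrier_of B" for x b
    using lightlike_splitting.tpart_J_in_radical[OF split[OF that] Jx(1,3,4)[OF that]] rad[OF that] by auto
  have a: "b \<in> Rad A g B x" if "x \<in> carrier_of B" "?t x (?JT x b) = real p *\<^sub>R ?s x b" for x b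
    by (rule lightlike_splitting.in_radical_if_tpart_J_eq[OF split Jx(1,3,4,2) _ that(2)])
      (use that assms(2) in auto)
  have *: "screen_shape_op A g B nab S Sperp ltr W U x = screen_shape_op A g B nab S Sperp ltr U W x
      \<longleftrightarrow> ?s x (lie_bracket B W U x) = 0"
    if "W \<in> ?\<Gamma>" "U \<in> ?\<Gamma>" "x \<in> carrier_of B" for W U x
    using diffs(2)[OF that] by (metis eq_iff_diff_eq_0)
  show ?thesis
    unfolding integrable_distribution_def
    by (simp add: diffs * b cong: ball_cong) (use a in blast)
qed

end
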